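(* Let $H\in\mathbb{F}_q[x]$ be a nonzero polynomial of degree $m$, let $n\ge 1$, let $\chi$ be a multiplicative character modulo $H$ on $\mathbb{F}_q[x]$ and let $\psi$ be an additive character modulo $H$ on $\mathbb{F}_q[x]$, such that $\chi$ and $\psi$ are not both principal. Let $G\in\mathbb{F}_q[x]$ be the polynomial associated to $\psi$ (so $\psi=\psi_G=E_\lambda(G,H)$), let $(G,H)$ be the monic greatest common divisor of $G$ and $H$, put $m_1=\deg (G,H)$ and $N=\frac{H}{(G,H)}$. Then $$(-1)^{m-m_1}\,\frac{\phi^{(n)}(N)}{\phi^{(n)}(H)}\,G(\chi^{(n)},\psi^{(n)})=\left((-1)^{m-m_1}\,\frac{\phi(N)}{\phi(H)}\,G(\chi,\psi)\right)^n .$$ In particular, if $H=P^k$ is a power ($k\ge 1$) of an irreducible polynomial $P\in\mathbb{F}_q[x]$, then $$(-1)^{m-m_1}\,G(\chi^{(n)},\psi^{(n)})=\left((-1)^{m-m_1}\,G(\chi,\psi)\right)^n .$$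
   Context: $\mathbb{F}_q$ is a finite field with $q$ elements and $\mathbb{F}_{q^n}$ its extension of degree $n$. The Frobenius $\sigma(a)=a^q$ of $\mathbb{F}_{q^n}$ is extended to $\mathbb{F}_{q^n}[x]$ by acting on coefficients. For $A\in\mathbb{F}_{q^n}[x]$ put $\mathrm{tr}(A)=\sum_{i=1}^n\sigma^i(A)$ and $\mathrm{N}(A)=\prod_{i=1}^n\sigma^i(A)$; both lie in $\mathbb{F}_q[x]$. An additive character modulo $H$ on $\mathbb{F}_q[x]$ is a complex-valued character of the additive group of $\mathbb{F}_q[x]/\langle H\rangle$, viewed as a function on $\mathbb{F}_q[x]$; it is principal if it is identically $1$. A multiplicative character modulo $H$ on $\mathbb{F}_q[x]$ is a complex-valued character of the group of units of $\mathbb{F}_q[x]/\langle H\rangle$, viewed as a function on $\mathbb{F}_q[x]$ with $\chi(A)=0$ if $A$ and $H$ are not coprime; it is principal if $\chi(A)=1$ for all $A$ coprime to $H$. The same definitions are used over $\mathbb{F}_{q^n}[x]$. The Gauss sum is $G(\chi,\psi)=\sum_{D \bmod H}\chi(D)\psi(D)$, with $D$ running over a complete residue system modulo $H$ in $\mathbb{F}_q[x]$. For $A\in\mathbb{F}_{q^n}[x]$, $\psi^{(n)}(A)=\psi(\mathrm{tr}(A))$ and $\chi^{(n)}(A)=\chi(\mathrm{N}(A))$; these are an additive and a multiplicative character modulo $H$ on $\mathbb{F}_{q^n}[x]$, and $G(\chi^{(n)},\psi^{(n)})=\sum_{D}\chi^{(n)}(D)\psi^{(n)}(D)$ with $D$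 running over a complete residue system modulo $H$ in $\mathbb{F}_{q^n}[x]$. Fix a non-principal (complex-valued) additive character $\lambda$ of $\mathbb{F}_q$. For $A\in\mathbb{F}_q[x]$ let $t(A)$ be the coefficient of $x^{m-1}$ in the remainder of $A$ modulo $H$, where $m=\deg H$ (so $t=0$ if $m=0$), and let $E_\lambda(G,H)(A)=\lambda(t(GA))$. Every additive character $\psi$ modulo $H$ on $\mathbb{F}_q[x]$ equals $\psi_G:=E_\lambda(G,H)$ for a unique $G\in\mathbb{F}_q[x]$ with $\deg G<\deg H$; this $G$ is called the polynomial associated to $\psi$ (if $\psi$ is principal then $G=0$ and $(G,H)$ is $H$ up to a unit). $\phi(H)$ is the Euler function on $\mathbb{F}_q[x]$, i.e. the number of units of $\mathbb{F}_q[x]/\langle H\rangle$, and $\phi^{(n)}(H)$ is the Euler function on $\mathbb{F}_{q^n}[x]$, i.e. the number of units of $\mathbb{F}_{q^n}[x]/\langle H\rangle$. *)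

theory Defs
  imports Complex_Main "HOL-Library.Cardinality"
    "HOL-Computational_Algebra.Computational_Algebra"
begin

text \<open>
  A finite field of order q and its extension of degree n are represented by two types of
  sort \<open>{field_gcd, finite}\<close>, together with a ring homomorphism \<open>\<iota>\<close> from
  the first to the second, where the cardinality of the second type is the n-th power of that of
  the first. The class \<open>field_gcd\<close> only adds the division, normalization and gcd operations
  to a field; it makes \<open>gcd\<close> on polynomials available, whose value is monic or zero.
\<close>

definition field_embedding :: "('a::field \<Rightarrow> 'b::field) \<Rightarrow> bool" where
  "field_embedding \<iota> \<longleftrightarrow>
     \<iota> 1 = 1 \<and> (\<forall>a b. \<iota> (a + b) = \<iota> a + \<iota> b) \<and> (\<forall>a b. \<iota> (a * b) = \<iota> a * \<iota> b)"

definition additive_char :: "('c::ab_group_add \<Rightarrow> complex) \<Rightarrow> bool" where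
  "additive_char f \<longleftrightarrow> f 0 = 1 \<and> (\<forall>a b. f (a + b) = f a * f b)"

definition principal_additive :: "('c \<Rightarrow> complex) \<Rightarrow> bool" where
  "principal_additive f \<longleftrightarrow> (\<forall>a. f a = 1)"

definition additive_char_mod :: "'c::field poly \<Rightarrow> ('c poly \<Rightarrow> complex) \<Rightarrow> bool" where
  "additive_char_mod H \<psi> \<longleftrightarrow>
     additive_char \<psi> \<and> (\<forall>A B. H dvd A - B \<longrightarrow> \<psi> A = \<psi> B)"

text \<open>
  Being coprime to \<open>H\<close> is the same as being a unit modulo \<open>H\<close>. If \<open>H\<close> is
  constant, every polynomial is coprime to \<open>H\<close> and the quotient is the zero ring, whose
  single element is a unit.
\<close>

definition mult_char_mod :: "'c::field poly \<Rightarrow> ('c poly \<Rightarrow> complex) \<Rightarrow> bool" where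
  "mult_char_mod H \<chi> \<longleftrightarrow>
     \<chi> 1 = 1 \<and>
     (\<forall>A B. coprime A H \<longrightarrow> coprime B H \<longrightarrow> \<chi> (A * B) = \<chi> A * \<chi> B) \<and>
     (\<forall>A B. H dvd A - B \<longrightarrow> \<chi> A = \<chi> B) \<and>
     (\<forall>A. \<not> coprime A H \<longrightarrow> \<chi> A = 0)"

definition principal_mult_mod :: "'c::field poly \<Rightarrow> ('c poly \<Rightarrow> complex) \<Rightarrow> bool" where
  "principal_mult_mod H \<chi> \<longleftrightarrow> (\<forall>A. coprime A H \<longrightarrow> \<chi> A = 1)"

definition residues_mod :: "'c::field poly \<Rightarrow> 'c poly set" where
  "residues_mod H = range (\<lambda>A. A mod H)"

definition gauss_sum ::
  "'c::field poly \<Rightarrow> ('c poly \<Rightarrow> complex) \<Rightarrow> ('c poly \<Rightarrow> complex) \<Rightarrow> complex" where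
  "gauss_sum H \<chi> \<psi> = (\<Sum>D\<in>residues_mod H. \<chi> D * \<psi> D)"

definition euler_phi :: "'c::field poly \<Rightarrow> nat" where
  "euler_phi H = card {D \<in> residues_mod H. \<exists>E. (D * E) mod H = 1 mod H}"

definition top_coeff_mod :: "'c::field poly \<Rightarrow> 'c poly \<Rightarrow> 'c" where
  "top_coeff_mod H A = (if degree H = 0 then 0 else coeff (A mod H) (degree H - 1))"

definition E_char :: "('c::field \<Rightarrow> complex) \<Rightarrow> 'c poly \<Rightarrow> 'c poly \<Rightarrow> 'c poly \<Rightarrow> complex" where
  "E_char lam G H A = lam (top_coeff_mod H (G * A))"

text \<open>
  The degree of the zero polynomial is minus infinity in the condition that the degree of
  \<open>G\<close> is less than that of \<open>H\<close>, whereas \<open>degree 0 = 0\<close> in the library.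
\<close>

definition associated_poly ::
  "('c::field \<Rightarrow> complex) \<Rightarrow> 'c poly \<Rightarrow> ('c poly \<Rightarrow> complex) \<Rightarrow> 'c poly \<Rightarrow> bool" where
  "associated_poly lam H \<psi> G \<longleftrightarrow>
     (G = 0 \<or> degree G < degree H) \<and> \<psi> = E_char lam G H"

definition frob_poly :: "nat \<Rightarrow> 'b::field poly \<Rightarrow> 'b poly" where
  "frob_poly q A = map_poly (\<lambda>a. a ^ q) A"

definition tr_poly :: "nat \<Rightarrow> nat \<Rightarrow> 'b::field poly \<Rightarrow> 'b poly" where
  "tr_poly q n A = (\<Sum>i=1..n. (frob_poly q ^^ i) A)"

definition norm_poly :: "nat \<Rightarrow> nat \<Rightarrow> 'b::field poly \<Rightarrow> 'b poly" where
  "norm_poly q n A = (\<Prod>i=1..n. (frob_poly q ^^ i) A)"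

text \<open>
  The trace and the norm are polynomials over the large field whose coefficients lie in the image
  of \<open>\<iota>\<close>. As \<open>map_poly \<iota>\<close> is injective, \<open>inv (map_poly \<iota>)\<close> takes them back to the small field.
\<close>

definition lift_additive ::
  "('a::{field,finite} \<Rightarrow> 'b::field) \<Rightarrow> nat \<Rightarrow> ('a poly \<Rightarrow> complex) \<Rightarrow> 'b poly \<Rightarrow> complex" where
  "lift_additive \<iota> n \<psi> A = \<psi> (inv (map_poly \<iota>) (tr_poly CARD('a) n A))"

definition lift_mult ::
  "('a::{field,finite} \<Rightarrow> 'b::field) \<Rightarrow> nat \<Rightarrow> ('a poly \<Rightarrow> complex) \<Rightarrow> 'b poly \<Rightarrow> complex" where
  "lift_mult \<iota> n \<chi> A = \<chi> (inv (map_poly \<iota>) (norm_poly CARD('a) n A))"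

end

theory Submission
  imports Defs
begin

text \<open>
  For a completely multiplicative function \<open>f\<close> on monic polynomials, the sums \<open>a\<^sub>k\<close> of \<open>f\<close> over
  the monic polynomials of degree \<open>k\<close> and the sums \<open>S\<^sub>j\<close> of \<open>degree P * f P ^ i\<close> over the prime
  powers \<open>P ^ i\<close> of degree \<open>j\<close> satisfy \<open>k a\<^sub>k = S\<^sub>1 a\<^sub>k\<^sub>-\<^sub>1 + ... + S\<^sub>k a\<^sub>0\<close>. If \<open>a\<^sub>k = 0\<close> for \<open>k > m\<close>,
  the generating function of \<open>a\<close> is a product of \<open>m\<close> factors \<open>1 - b X\<close>, and \<open>S\<^sub>j\<close> is minus the sum
  of the \<open>b ^ j\<close>. Over the extension field, the power sums of \<open>f \<circ> NM\<close>, with \<open>NM\<close> the norm, are the \<open>S\<^sub>n\<^sub>k\<close>,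
  so its generating function is the product of the \<open>1 - b ^ n X\<close>. Comparing the coefficients of \<open>X ^ m\<close>
  gives \<open>(-1)\<^sup>m a'\<^sub>m = ((-1)\<^sup>m a\<^sub>m)\<^sup>n\<close>.

  For \<open>f F = \<chi> F * \<lambda> c\<close>, where \<open>c\<close> is the second coefficient of \<open>F\<close> and \<open>m\<close> is the degree of the
  modulus \<open>H\<close>, the number \<open>a\<^sub>m\<close> is a Gauss sum up to a constant factor, because the monic polynomials
  of degree \<open>m\<close> are a monic multiple of \<open>H\<close> plus a residue. This settles the case where \<open>G\<close> is coprime
  to \<open>H\<close>. In general \<open>\<psi>\<close> is a character modulo \<open>N\<close>: either \<open>\<chi>\<close> descends to a character modulo \<open>N\<close>,
  and the coprime case applies to \<open>N\<close>, or \<open>\<chi>\<close> is nontrivial on the units congruent to 1 modulo \<open>N\<close>;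
  then so is \<open>\<chi> \<circ> NM\<close>, and both Gauss sums vanish.
\<close>

subsection \<open>Monic polynomials\<close>

text \<open>Phrased by coefficients so that 0 belongs to every set, also for \<open>m = 0\<close>,
  and closure under sums and differences is immediate.\<close>

definition polys_less :: "nat \<Rightarrow> 'c::zero poly set" where
  "polys_less m = {p. \<forall>i\<ge>m. coeff p i = 0}"

definition monics :: "nat \<Rightarrow> 'c::field poly set" where
  "monics k = {F. lead_coeff F = 1 \<and> degree F = k}"

lemma polys_less_altdef:
  "polys_less m = {p :: 'c::zero poly. p = 0 \<or> degree p < m}"
proof -
  have "(\<forall>i\<ge>m. coeff p i = 0) \<longleftrightarrow> p = 0 \<or> degree p < m" for p :: "'c poly"
    by (metis coeff_eq_0 leading_coeff_0_iff linorder_not_le order_less_le_trans coeff_0)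
  thus ?thesis by (auto simp: polys_less_def)
qed

lemma polys_less_Suc:
  "polys_less (Suc m) = (\<lambda>(a, p). pCons a p) ` (UNIV \<times> (polys_less m :: 'c::zero poly set))"
proof (intro equalityI subsetI)
  fix p :: "'c poly" assume p: "p \<in> polys_less (Suc m)"
  obtain a r where r: "p = pCons a r" by (cases p)
  have "r \<in> polys_less m"
    using p unfolding polys_less_def r by (force simp: coeff_pCons split: nat.splits)
  thus "p \<in> (\<lambda>(a, p). pCons a p) ` (UNIV \<times> polys_less m)" using r by force
qed (auto simp: polys_less_def coeff_pCons split: nat.splits)

lemma polys_less_finite_card:
  "finite (polys_less m :: 'c::{zero,finite} poly set) \<and>
   card (polys_less m :: 'c poly set) = CARD('c) ^ m"
proof (induction m)
  case 0
  have "polys_less 0 = {0 :: 'c poly}" by (auto simp: polys_less_altdef)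
  thus ?case by simp
next
  case (Suc m)
  have "inj_on (\<lambda>(a, p). pCons a p) (UNIV \<times> (polys_less m :: 'c poly set))"
    by (auto simp: inj_on_def)
  thus ?case using Suc unfolding polys_less_Suc
    by (simp add: card_image card_cartesian_product)
qed

lemmas finite_polys_less = polys_less_finite_card [THEN conjunct1]
lemmas card_polys_less = polys_less_finite_card [THEN conjunct2]

lemma monics_nonzero [simp]: "F \<in> monics k \<Longrightarrow> F \<noteq> 0"
  by (auto simp: monics_def)

lemma monics_0: "monics 0 = {1}"
  by (auto simp: monics_def elim!: degree_eq_zeroE)

lemma monics_add_polys_less:
  assumes "F \<in> monics k" "D \<in> polys_less k"
  shows   "F + D \<in> monics k"
proof (cases "D = 0")
  case False
  hence "degree D < degree F" using assms by (auto simp: monics_def polys_less_altdef)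
  thus ?thesis using assms
    by (auto simp: monics_def degree_add_eq_left coeff_eq_0)
qed (use assms in auto)

lemma monics_diff_polys_less:
  assumes "F \<in> monics k" "F' \<in> monics k"
  shows   "F' - F \<in> polys_less k"
  using assms by (auto simp: monics_def polys_less_def coeff_eq_0 le_less)

text \<open>The monic polynomials of degree \<open>k\<close> are a coset of
  \<open>polys_less k\<close>. The base point \<open>monom 1 k\<close> gives their number; a monic
  multiple of \<open>H\<close> will bring in the residues modulo \<open>H\<close>.\<close>

lemma bij_betw_monics:
  assumes "F \<in> monics k"
  shows   "bij_betw (\<lambda>D. F + D) (polys_less k) (monics k)"
  by (rule bij_betwI[where g = "\<lambda>F'. F' - F"])
     (use assms in \<open>auto intro: monics_add_polys_less monics_diff_polys_less\<close>)

lemma monom_in_monics: "monom 1 k \<in> monics k"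
  by (simp add: monics_def degree_monom_eq)

lemma finite_monics [simp]: "finite (monics k :: 'c::{field,finite} poly set)"
  using bij_betw_finite[OF bij_betw_monics[OF monom_in_monics]] finite_polys_less by blast

lemma card_monics: "card (monics k :: 'c::{field,finite} poly set) = CARD('c) ^ k"
  using bij_betw_same_card[OF bij_betw_monics[OF monom_in_monics]] card_polys_less by metis

lemma monics_mult: "F \<in> monics k \<Longrightarrow> G \<in> monics l \<Longrightarrow> F * G \<in> monics (k + l)"
  by (cases "F = 0 \<or> G = 0") (auto simp: monics_def degree_mult_eq coeff_mult_degree_sum)

lemma monics_power: "F \<in> monics k \<Longrightarrow> F ^ i \<in> monics (i * k)"
  by (induction i) (auto simp: monics_0 intro: monics_mult)

lemma monics_prod:
  assumes "\<And>x. x \<in> A \<Longrightarrow> f x \<in> monics k"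
  shows   "prod f A \<in> monics (card A * k)"
  using assms by (induction A rule: infinite_finite_induct) (auto simp: monics_0 intro: monics_mult)

lemma monics_divide:
  assumes "F * G \<in> monics k" "F \<in> monics l"
  shows   "l \<le> k" "G \<in> monics (k - l)"
proof -
  have nz: "F \<noteq> 0" "G \<noteq> 0" using assms(1) by (auto simp: monics_def)
  hence d: "k = l + degree G" using assms by (auto simp: monics_def degree_mult_eq)
  show "l \<le> k" using d by simp
  have "lead_coeff (F * G) = 1" "lead_coeff F = 1" using assms unfolding monics_def by blast+
  hence "lead_coeff G = 1" by (simp only: lead_coeff_mult mult_1)
  thus "G \<in> monics (k - l)" using d by (simp add: monics_def)
qed

lemma monics_unit_factor:
  fixes P :: "'c::field_gcd poly"
  assumes "unit_factor P = 1"
  shows   "P \<in> monics (degree P)"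
proof -
  have "P \<noteq> 0" using assms by auto
  have "unit_factor (lead_coeff P) = 1"
    using assms by (simp add: unit_factor_poly_def one_pCons)
  moreover have "is_unit (lead_coeff P)" using \<open>P \<noteq> 0\<close> by (simp add: dvd_field_iff)
  ultimately have "lead_coeff P = 1" using is_unit_unit_factor by metis
  thus ?thesis by (simp add: monics_def)
qed

text \<open>\<open>prime\<close> asks for a normalized element, so it singles out the monic
  irreducible polynomials.\<close>

lemma prime_poly_monic:
  fixes P :: "'c::field_gcd poly"
  assumes "prime P"
  shows   "P \<in> monics (degree P)" "degree P > 0"
proof -
  show "P \<in> monics (degree P)" using assms by (intro monics_unit_factor) simp
  show "degree P > 0"
    using assms by (metis is_unit_iff_degree not_prime_unit not_prime_0 bot_nat_0.not_eq_extremum)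
qed

lemma normalize_monic:
  fixes F :: "'c::field_gcd poly"
  assumes "F \<in> monics k"
  shows   "normalize F = F"
  using assms by (intro poly_eqI) (auto simp: monics_def)

subsection \<open>Power sums of a character on monic polynomials\<close>

definition prime_pows :: "nat \<Rightarrow> ('c::field_gcd poly \<times> nat) set" where
  "prime_pows j = {(P, i). prime P \<and> i \<ge> 1 \<and> i * degree P = j}"

lemma prime_pows_0 [simp]: "prime_pows 0 = {}"
  using prime_poly_monic(2) by (auto simp: prime_pows_def)

lemma finite_prime_pows [simp]: "finite (prime_pows j :: ('c::{field_gcd,finite} poly \<times> nat) set)"
proof (rule finite_subset)
  show "prime_pows j \<subseteq> (\<Union>k\<le>j. monics k :: 'c poly set) \<times> {..j}"
  proof
    fix x :: "'c poly \<times> nat" assume x: "x \<in> prime_pows j"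
    obtain P i where Pi: "x = (P, i)" by (cases x)
    have P: "prime P" "i \<ge> 1" "i * degree P = j" using x by (auto simp: prime_pows_def Pi)
    have "degree P \<le> j" "i \<le> j" using P prime_poly_monic(2)[OF P(1)] by auto
    thus "x \<in> (\<Union>k\<le>j. monics k) \<times> {..j}"
      using prime_poly_monic(1)[OF P(1)] unfolding Pi by blast
  qed
qed auto

definition char_coeff :: "('c::field_gcd poly \<Rightarrow> complex) \<Rightarrow> nat \<Rightarrow> complex" where
  "char_coeff f k = (\<Sum>F\<in>monics k. f F)"

text \<open>The analogue of von Mangoldt's function, twisted by \<open>f\<close> and summed in
  degree \<open>j\<close>. For multiplicative \<open>f\<close> these are the coefficients of
  \<open>X L' / L\<close>, where \<open>L\<close> is the generating series of
  \<open>char_coeff f\<close>.\<close>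

definition char_pow_sum :: "('c::field_gcd poly \<Rightarrow> complex) \<Rightarrow> nat \<Rightarrow> complex" where
  "char_pow_sum f j = (\<Sum>(P, i)\<in>prime_pows j. of_nat (degree P) * f P ^ i)"

text \<open>Multiplicativity is confined to monic arguments because the second coefficient turns
  products into sums only there.\<close>

definition monic_char :: "('c::field_gcd poly \<Rightarrow> complex) \<Rightarrow> bool" where
  "monic_char f \<longleftrightarrow> f 1 = 1 \<and>
     (\<forall>F G. lead_coeff F = 1 \<longrightarrow> lead_coeff G = 1 \<longrightarrow> f (F * G) = f F * f G)"

lemma monic_char_mult:
  "monic_char f \<Longrightarrow> F \<in> monics k \<Longrightarrow> G \<in> monics l \<Longrightarrow> f (F * G) = f F * f G"
  by (auto simp: monic_char_def monics_def)

lemma monic_char_power: "monic_char f \<Longrightarrow> F \<in> monics k \<Longrightarrow> f (F ^ i) = f F ^ i"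
proof (induction i)
  case (Suc i)
  thus ?case using monic_char_mult[OF Suc.prems(1) Suc.prems(2) monics_power[OF Suc.prems(2)]] by simp
qed (simp add: monic_char_def)

text \<open>The polynomial form of writing \<open>log n\<close> as the sum of von Mangoldt's
  function over the divisors of \<open>n\<close>: a prime \<open>P\<close> contributes
  \<open>degree P\<close> once for each of its powers dividing \<open>F\<close>.\<close>

lemma degree_conv_prime_pows:
  fixes F :: "'c::{field_gcd,finite} poly"
  assumes F: "F \<in> monics k"
  shows   "k = (\<Sum>j=1..k. \<Sum>(P, i)\<in>{x \<in> prime_pows j. fst x ^ snd x dvd F}. degree P)"
proof -
  have nz [simp]: "F \<noteq> 0" using F by simp
  define S where "S = (SIGMA P:prime_factors F. {1..multiplicity P F})"
  have "k = degree (\<Prod>P\<in>prime_factors F. P ^ multiplicity P F)"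
    using F prod_prime_factors[of F] by (simp add: normalize_monic[OF F]) (simp add: monics_def)
  also have "\<dots> = (\<Sum>P\<in>prime_factors F. degree (P ^ multiplicity P F))"
    by (rule degree_prod_eq_sum_degree) auto
  also have "\<dots> = (\<Sum>P\<in>prime_factors F. \<Sum>i\<in>{1..multiplicity P F}. degree P)"
    by (intro sum.cong refl) (auto simp: degree_power_eq dest: in_prime_factors_imp_prime)
  also have "\<dots> = (\<Sum>(P, i)\<in>S. degree P)"
    unfolding S_def by (subst sum.Sigma) auto
  also have "S = (\<Union>j\<in>{1..k}. {x \<in> prime_pows j. fst x ^ snd x dvd F})"
  proof (intro equalityI subsetI; clarify)
    fix P i assume "(P, i) \<in> S"
    hence P: "prime P" "i \<ge> 1" "P ^ i dvd F"
      by (auto simp: S_def in_prime_factors_imp_prime multiplicity_dvd')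
    then obtain R where R: "F = P ^ i * R" by (elim dvdE)
    have "i * degree P \<le> k"
      using monics_divide(1)[OF F[unfolded R] monics_power[OF prime_poly_monic(1)[OF P(1)]]] .
    thus "(P, i) \<in> (\<Union>j\<in>{1..k}. {x \<in> prime_pows j. fst x ^ snd x dvd F})"
      using P prime_poly_monic(2)[OF P(1)] by (auto simp: prime_pows_def)
  next
    fix j P i assume "(P, i) \<in> prime_pows j" "fst (P, i) ^ snd (P, i) dvd F"
    hence P: "prime P" "i \<ge> 1" "P ^ i dvd F" by (auto simp: prime_pows_def)
    hence "i \<le> multiplicity P F" by (intro multiplicity_geI) auto
    thus "(P, i) \<in> S" using P by (auto simp: S_def prime_factors_multiplicity)
  qed
  also have "(\<Sum>(P, i)\<in>\<dots>. degree P) = (\<Sum>j=1..k. \<Sum>(P, i)\<in>{x \<in> prime_pows j. fst x ^ snd x dvd F}. degree P)"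
    by (subst sum.UNION_disjoint) (simp, simp, auto simp: prime_pows_def)
  finally show ?thesis .
qed

text \<open>Weight \<open>f F\<close> by the degree \<open>k\<close>, expand this degree by
  \<open>degree_conv_prime_pows\<close> and exchange the sums; the \<open>F\<close> divisible by
  \<open>P ^ i\<close> are then \<open>P ^ i * R\<close> with \<open>R\<close> monic of degree
  \<open>k - j\<close>.\<close>

lemma char_coeff_recurrence:
  fixes f :: "'c::{field_gcd,finite} poly \<Rightarrow> complex"
  assumes f: "monic_char f"
  shows "of_nat k * char_coeff f k = (\<Sum>j=1..k. char_pow_sum f j * char_coeff f (k - j))"
proof -
  let ?D = "\<lambda>F j. {x \<in> prime_pows j. fst x ^ snd x dvd F}"
  have "of_nat k * char_coeff f k = (\<Sum>F\<in>monics k. of_nat k * f F)"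
    by (simp add: char_coeff_def sum_distrib_left)
  also have "\<dots> = (\<Sum>F\<in>monics k. (\<Sum>j=1..k. \<Sum>x\<in>?D F j. of_nat (degree (fst x))) * f F)"
  proof (intro sum.cong refl)
    fix F :: "'c poly" assume "F \<in> monics k"
    from degree_conv_prime_pows[OF this]
    have "k = (\<Sum>j=1..k. \<Sum>x\<in>?D F j. degree (fst x))" by (simp add: case_prod_unfold)
    hence "(of_nat k :: complex) = (\<Sum>j=1..k. \<Sum>x\<in>?D F j. of_nat (degree (fst x)))"
      by (metis (no_types, lifting) of_nat_sum sum.cong)
    thus "of_nat k * f F = (\<Sum>j=1..k. \<Sum>x\<in>?D F j. of_nat (degree (fst x))) * f F" by simp
  qed
  also have "\<dots> = (\<Sum>F\<in>monics k. \<Sum>j=1..k. \<Sum>x\<in>?D F j. of_nat (degree (fst x)) * f F)"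
    by (simp add: sum_distrib_right)
  also have "\<dots> = (\<Sum>j=1..k. \<Sum>F\<in>monics k. \<Sum>x\<in>?D F j. of_nat (degree (fst x)) * f F)"
    by (rule sum.swap)
  also have "\<dots> = (\<Sum>j=1..k. \<Sum>x\<in>prime_pows j. \<Sum>F | F \<in> monics k \<and> fst x ^ snd x dvd F.
                    of_nat (degree (fst x)) * f F)"
    by (intro sum.cong refl sum.swap_restrict) auto
  also have "\<dots> = (\<Sum>j=1..k. \<Sum>x\<in>prime_pows j. \<Sum>R\<in>monics (k - j).
                    of_nat (degree (fst x)) * (f (fst x) ^ snd x * f R))"
  proof (rule sum.cong[OF refl], rule sum.cong[OF refl])
    fix j x assume j: "j \<in> {1..k}" and x: "(x :: 'c poly \<times> nat) \<in> prime_pows j"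
    obtain P i where Pi: "x = (P, i)" by (cases x)
    have P: "prime P" "i \<ge> 1" "i * degree P = j" using x by (auto simp: prime_pows_def Pi)
    have m: "P ^ i \<in> monics j" using monics_power[OF prime_poly_monic(1)[OF P(1)], of i] P by simp
    have "bij_betw (\<lambda>R. P ^ i * R) (monics (k - j)) {F. F \<in> monics k \<and> P ^ i dvd F}"
    proof (rule bij_betw_imageI)
      show "inj_on (\<lambda>R. P ^ i * R) (monics (k - j))" using P(1) by (auto simp: inj_on_def)
      show "(\<lambda>R. P ^ i * R) ` monics (k - j) = {F. F \<in> monics k \<and> P ^ i dvd F}"
        using monics_mult[OF m, of _ "k - j"] monics_divide(2)[OF _ m, of _ k] j
        by (auto elim!: dvdE)
    qed
    hence "(\<Sum>F | F \<in> monics k \<and> P ^ i dvd F. of_nat (degree P) * f F)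
         = (\<Sum>R\<in>monics (k - j). of_nat (degree P) * f (P ^ i * R))"
      by (rule sum.reindex_bij_betw [symmetric])
    also have "\<dots> = (\<Sum>R\<in>monics (k - j). of_nat (degree P) * (f P ^ i * f R))"
      by (intro sum.cong refl)
         (simp add: monic_char_mult[OF f m] monic_char_power[OF f prime_poly_monic(1)[OF P(1)]])
    finally show "(\<Sum>F | F \<in> monics k \<and> fst x ^ snd x dvd F. of_nat (degree (fst x)) * f F)
         = (\<Sum>R\<in>monics (k - j). of_nat (degree (fst x)) * (f (fst x) ^ snd x * f R))"
      by (simp add: Pi)
  qed
  also have "\<dots> = (\<Sum>j=1..k. char_pow_sum f j * char_coeff f (k - j))"
    by (simp add: char_pow_sum_def char_coeff_def case_prod_unfold sum_product mult.assoc)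
  finally show ?thesis .
qed

subsection \<open>Power series and their logarithmic derivatives\<close>

text \<open>Since \<open>W\<close> has no constant term, comparing coefficients expresses
  \<open>k\<close> times coefficient \<open>k\<close> through earlier coefficients, and
  \<open>k > 0\<close> is invertible in the complex numbers.\<close>

lemma fps_log_deriv_unique:
  fixes A B W :: "complex fps"
  assumes "fps_X * fps_deriv A = W * A" "fps_X * fps_deriv B = W * B"
    and "fps_nth A 0 = fps_nth B 0" "fps_nth W 0 = 0"
  shows   "A = B"
proof (rule fps_ext)
  have rec: "of_nat k * fps_nth C k = (\<Sum>j=1..k. fps_nth W j * fps_nth C (k - j))"
    if "fps_X * fps_deriv C = W * C" "k > 0" for C k
  proof -
    have "of_nat k * fps_nth C k = fps_nth (fps_X * fps_deriv C) k"
      using that(2) by (cases k) auto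
    also have "\<dots> = (\<Sum>j=0..k. fps_nth W j * fps_nth C (k - j))"
      by (simp add: that fps_mult_nth)
    also have "\<dots> = (\<Sum>j=1..k. fps_nth W j * fps_nth C (k - j))"
      by (subst sum.atLeast_Suc_atMost) (use assms(4) in auto)
    finally show ?thesis .
  qed
  show "fps_nth A k = fps_nth B k" for k
  proof (induction k rule: less_induct)
    case (less k)
    show ?case
    proof (cases "k = 0")
      case False
      hence "k > 0" by simp
      have "of_nat k * fps_nth A k = (of_nat k * fps_nth B k :: complex)"
        unfolding rec[OF assms(1) \<open>k > 0\<close>] rec[OF assms(2) \<open>k > 0\<close>]
        by (intro sum.cong refl) (use less.IH False in auto)
      thus ?thesis using False by simp
    qed (use assms in auto)
  qed
qed

definition fps_root_prod :: "complex list \<Rightarrow> complex fps" where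
  "fps_root_prod bs = (\<Prod>b\<leftarrow>bs. 1 - fps_const b * fps_X)"

text \<open>The logarithmic derivative \<open>X A' / A\<close> of
  \<open>A = fps_root_prod bs\<close>: up to sign, the power sums of the \<open>b\<close>.\<close>

definition fps_root_pows :: "complex list \<Rightarrow> complex fps" where
  "fps_root_pows bs = Abs_fps (\<lambda>k. if k = 0 then 0 else - (\<Sum>b\<leftarrow>bs. b ^ k))"

lemma fps_root_prod_deriv:
  "fps_X * fps_deriv (fps_root_prod bs) = fps_root_pows bs * fps_root_prod bs"
proof (induction bs)
  case (Cons b bs)
  \<comment> \<open>\<open>g\<close> is the geometric expansion of \<open>- b X / (1 - b X)\<close>,
    the contribution of the single factor \<open>1 - b X\<close>.\<close>
  define g where "g = Abs_fps (\<lambda>k. if k = 0 then 0 else - (b ^ k))"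
  have g: "g * (1 - fps_const b * fps_X) = - fps_const b * fps_X"
  proof (rule fps_ext)
    fix k
    have "g * (1 - fps_const b * fps_X) = g - fps_const b * (fps_X * g)"
      by (simp add: algebra_simps)
    thus "fps_nth (g * (1 - fps_const b * fps_X)) k = fps_nth (- fps_const b * fps_X) k"
      by (cases k; cases "k - 1") (auto simp: g_def)
  qed
  have pows: "fps_root_pows (b # bs) = g + fps_root_pows bs"
    by (rule fps_ext) (simp add: fps_root_pows_def g_def)
  have "fps_X * fps_deriv (fps_root_prod (b # bs)) =
          (1 - fps_const b * fps_X) * (fps_X * fps_deriv (fps_root_prod bs))
          + (- fps_const b * fps_X) * fps_root_prod bs"
    by (simp add: fps_root_prod_def algebra_simps flip: fps_const_neg)
  also have "\<dots> = fps_root_pows (b # bs) * fps_root_prod (b # bs)"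
    unfolding Cons.IH g[symmetric] pows by (simp add: fps_root_prod_def algebra_simps)
  finally show ?case .
qed (auto simp: fps_root_prod_def fps_root_pows_def intro!: fps_ext)

text \<open>The vanishing beyond \<open>length bs\<close> is carried along for the induction: it
  removes one of the two terms in the recursion for the top coefficient.\<close>

lemma fps_root_prod_nth_length:
  "fps_nth (fps_root_prod bs) (length bs) = (-1) ^ length bs * prod_list bs \<and>
   (\<forall>k>length bs. fps_nth (fps_root_prod bs) k = 0)"
proof (induction bs)
  case (Cons b bs)
  have "fps_root_prod (b # bs) = fps_root_prod bs - fps_const b * (fps_X * fps_root_prod bs)"
    by (simp add: fps_root_prod_def algebra_simps)
  hence "fps_nth (fps_root_prod (b # bs)) (Suc k) =
           fps_nth (fps_root_prod bs) (Suc k) - b * fps_nth (fps_root_prod bs) k" for k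
    by simp
  thus ?case using Cons by (auto simp: Suc_less_eq2)
qed (auto simp: fps_root_prod_def)

lemma fps_root_prod_nth_0 [simp]: "fps_nth (fps_root_prod bs) 0 = 1"
  by (induction bs) (auto simp: fps_root_prod_def)

lemma fps_root_prod_append: "fps_root_prod (as @ bs) = fps_root_prod as * fps_root_prod bs"
  by (simp add: fps_root_prod_def)

text \<open>The constant term 1 makes all roots \<open>x\<close> nonzero, so each factor
  \<open>X - x\<close> can be rewritten as \<open>- x * (1 - X / x)\<close>; all constants together
  multiply to 1.\<close>

lemma fps_eq_root_prod:
  fixes A :: "complex fps"
  assumes A0: "fps_nth A 0 = 1" and Am: "\<And>k. k > m \<Longrightarrow> fps_nth A k = 0"
  obtains bs where "length bs = m" "A = fps_root_prod bs"
proof -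
  define p where "p = Poly (map (fps_nth A) [0..<Suc m])"
  have p: "A = fps_of_poly p"
    by (rule fps_ext) (use Am in \<open>auto simp: p_def nth_default_def simp del: upt_Suc\<close>)
  have p0: "coeff p 0 = 1" using A0 by (simp add: p)
  hence "p \<noteq> 0" by auto
  then obtain M where M: "size M = degree p" "p = smult (lead_coeff p) (\<Prod>x\<in>#M. [:-x, 1:])"
    using alg_closed_imp_factorization by blast
  obtain xs where xs: "mset xs = M" using ex_mset by blast
  have p2: "p = smult (lead_coeff p) (\<Prod>x\<leftarrow>xs. [:-x, 1:])"
    using M(2) by (simp flip: xs prod_mset_prod_list mset_map)
  have len: "length xs = degree p" using M(1) xs by auto
  have le: "degree p \<le> m"
    by (rule degree_le) (use Am in \<open>auto simp: p_def nth_default_def simp del: upt_Suc\<close>)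
  have "poly (\<Prod>x\<leftarrow>ys. [:-x, 1:]) 0 = (\<Prod>x\<leftarrow>ys. - x)" for ys :: "complex list"
    by (induction ys) auto
  hence "poly p 0 = lead_coeff p * (\<Prod>x\<leftarrow>xs. - x)" by (subst p2) simp
  hence pr: "lead_coeff p * (\<Prod>x\<leftarrow>xs. - x) = 1" using p0 by (simp add: poly_0_coeff_0)
  hence nz: "x \<noteq> 0" if "x \<in> set xs" for x
    using that prod_list_zero_iff[of "map uminus xs"] by fastforce
  have fac: "fps_of_poly (\<Prod>x\<leftarrow>ys. [:-x, 1:]) =
               fps_const (\<Prod>x\<leftarrow>ys. - x) * fps_root_prod (map inverse ys)"
    if "\<And>y. y \<in> set ys \<Longrightarrow> y \<noteq> (0::complex)" for ys
    using that
  proof (induction ys)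
    case (Cons y ys)
    have "fps_of_poly [:-y, 1:] = fps_const (- y) * (1 - fps_const (inverse y) * fps_X)"
      using Cons.prems by (intro fps_ext) (auto simp: coeff_pCons fps_of_poly_pCons split: nat.splits)
    moreover have "fps_of_poly (\<Prod>x\<leftarrow>ys. [:-x, 1:]) =
               fps_const (\<Prod>x\<leftarrow>ys. - x) * fps_root_prod (map inverse ys)"
      using Cons.prems by (intro Cons.IH) auto
    ultimately have "fps_of_poly (\<Prod>x\<leftarrow>y # ys. [:-x, 1:]) =
             (fps_const (- y) * (1 - fps_const (inverse y) * fps_X)) *
             (fps_const (\<Prod>x\<leftarrow>ys. - x) * fps_root_prod (map inverse ys))"
      by (simp only: list.map prod_list.Cons fps_of_poly_mult)
    also have "\<dots> = (fps_const (- y) * fps_const (\<Prod>x\<leftarrow>ys. - x)) *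
                     ((1 - fps_const (inverse y) * fps_X) * fps_root_prod (map inverse ys))"
      by (simp only: mult_ac)
    finally show ?case by (simp add: fps_root_prod_def)
  qed (auto simp: fps_root_prod_def)
  have "A = fps_const (lead_coeff p) * fps_of_poly (\<Prod>x\<leftarrow>xs. [:-x, 1:])"
    unfolding p by (subst p2) (simp add: fps_of_poly_smult)
  also have "\<dots> = fps_const (lead_coeff p * (\<Prod>x\<leftarrow>xs. - x)) * fps_root_prod (map inverse xs)"
    by (subst fac) (use nz in \<open>auto simp: mult_ac simp flip: fps_const_mult\<close>)
  \<comment> \<open>Entries 0 stand for factors 1. They fill the list up to length \<open>m\<close>
    when the degree of \<open>p\<close> is smaller.\<close>
  also have "\<dots> = fps_root_prod (map inverse xs @ replicate (m - degree p) 0)"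
    by (simp add: pr fps_root_prod_append) (simp add: fps_root_prod_def)
  finally have "A = fps_root_prod (map inverse xs @ replicate (m - degree p) 0)" .
  moreover have "length (map inverse xs @ replicate (m - degree p) 0) = m"
    using len le by simp
  ultimately show ?thesis using that by blast
qed

lemma fps_log_deriv_power:
  fixes A B S T :: "complex fps"
  assumes A: "fps_X * fps_deriv A = S * A" "fps_nth A 0 = 1" "\<And>k. k > m \<Longrightarrow> fps_nth A k = 0"
    and B: "fps_X * fps_deriv B = T * B" "fps_nth B 0 = 1"
    and T: "fps_nth T 0 = 0" "\<And>k. k > 0 \<Longrightarrow> fps_nth T k = fps_nth S (n * k)" and n: "n > 0"
  shows "(-1) ^ m * fps_nth B m = ((-1) ^ m * fps_nth A m) ^ n"
proof -
  obtain bs where bs: "length bs = m" "A = fps_root_prod bs"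
    using fps_eq_root_prod[of A m] A by blast
  have "A \<noteq> 0" using A(2) by auto
  hence S: "S = fps_root_pows bs"
    using A(1) fps_root_prod_deriv[of bs] by (simp add: bs(2))
  define cs where "cs = map (\<lambda>b. b ^ n) bs"
  have "T = fps_root_pows cs"
  proof (rule fps_ext)
    fix k show "fps_nth T k = fps_nth (fps_root_pows cs) k"
      using T n by (cases "k = 0") (auto simp: S fps_root_pows_def cs_def o_def power_mult)
  qed
  hence "B = fps_root_prod cs"
    using fps_log_deriv_unique[of B T "fps_root_prod cs"] B T(1) fps_root_prod_deriv[of cs] by simp
  hence "(-1) ^ m * fps_nth B m = prod_list cs"
    using fps_root_prod_nth_length[of cs] bs(1) by (simp add: cs_def)
  also have "prod_list cs = prod_list bs ^ n"
    unfolding cs_def by (induction bs) (auto simp: power_mult_distrib)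
  also have "prod_list bs = (-1) ^ m * fps_nth A m"
    using fps_root_prod_nth_length[of bs] by (simp add: bs)
  finally show ?thesis .
qed

subsection \<open>Extensions of finite fields\<close>

text \<open>Multiplication by a nonzero \<open>x\<close> permutes the nonzero elements, so comparing
  their products shows that power \<open>CARD('c) - 1\<close> of \<open>x\<close> is 1; the proof
  carries one extra factor \<open>x\<close>.\<close>

lemma power_CARD_eq_same:
  fixes x :: "'c::{field,finite}"
  shows "x ^ CARD('c) = x"
proof (cases "x = 0")
  case False
  have "x * (\<Prod>y\<in>UNIV-{0}. x * y) = x ^ Suc (CARD('c) - 1) * \<Prod>(UNIV-{0})"
    by (simp only: power_Suc) (simp add: prod.distrib mult_ac)
  also have "Suc (CARD('c) - 1) = CARD('c)"
    using finite_UNIV_card_ge_0[where ?'a = 'c] by simp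
  also have "(\<Prod>y\<in>UNIV-{0}. x * y) = (\<Prod>y\<in>UNIV-{0}. y)"
    by (rule prod.reindex_bij_witness[of _ "\<lambda>y. y / x" "\<lambda>y. x * y"]) (use False in auto)
  finally show ?thesis by simp
qed (use finite_UNIV_card_ge_0[where ?'a = 'c] in auto)

lemma card_field_gt_1: "CARD('c::{field,finite}) > 1"
proof -
  have "card {0, 1 :: 'c} \<le> CARD('c)" by (intro card_mono) auto
  thus ?thesis by simp
qed

text \<open>
  The degree of \<open>(Y + 1)\<^sup>q - Y\<^sup>q - 1\<close> is less than \<open>q\<close>, and it vanishes on the field with \<open>q\<close> elements,
  so it is zero.
\<close>
lemma poly_plus_one_power_CARD:
  "[:1, 1:] ^ CARD('c) = monom 1 CARD('c) + (1 :: 'c::{field,finite} poly)"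
proof (rule ccontr)
  let ?q = "CARD('c)" and ?A = "[:1, 1:] ^ CARD('c) :: 'c poly"
    and ?B = "monom 1 CARD('c) + (1 :: 'c poly)"
  assume neq: "?A \<noteq> ?B"
  have q: "?q > 0" using card_field_gt_1[where 'c='c] by simp
  have A: "?A \<in> monics ?q"
    using monics_power[of "[:1, 1:] :: 'c poly" 1 ?q] by (simp add: monics_def del: One_nat_def) auto
  have B: "?B \<in> monics ?q"
    by (rule monics_add_polys_less[OF monom_in_monics]) (use q in \<open>auto simp: polys_less_altdef\<close>)
  have "?A - ?B \<in> polys_less ?q" by (rule monics_diff_polys_less[OF B A])
  hence "degree (?A - ?B) < ?q" using neq by (auto simp: polys_less_altdef)
  moreover have "{x. poly (?A - ?B) x = 0} = UNIV"
    by (auto simp: poly_monom power_CARD_eq_same)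
  moreover have "card {x. poly (?A - ?B) x = 0} \<le> degree (?A - ?B)"
    using neq by (intro card_poly_roots_bound) auto
  ultimately show False by simp
qed

section \<open>Embedding the polynomial ring over the small field into that over the large
  field\<close>

locale finite_field_ext =
  fixes \<iota> :: "'a::{field_gcd,finite} \<Rightarrow> 'b::{field_gcd,finite}" and n q :: nat
  assumes q_def: "q = CARD('a)" and n: "n \<ge> 1"
    and emb: "field_embedding \<iota>"
    and card_ext: "CARD('b) = q ^ n"
begin

abbreviation "J \<equiv> map_poly \<iota>"

abbreviation "\<sigma> \<equiv> frob_poly q :: 'b poly \<Rightarrow> 'b poly"

lemma q_gt_1: "q > 1"
  using card_field_gt_1[where 'c='a] by (simp add: q_def)

lemma power_q: "x ^ q = (x :: 'a)"
  by (simp add: q_def power_CARD_eq_same)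

lemma power_q_n: "x ^ (q ^ n) = (x :: 'b)"
  using power_CARD_eq_same[of x] by (simp add: card_ext)

lemma \<iota>_add: "\<iota> (a + b) = \<iota> a + \<iota> b" and \<iota>_mult: "\<iota> (a * b) = \<iota> a * \<iota> b"
  and \<iota>_1 [simp]: "\<iota> 1 = 1"
  using emb unfolding field_embedding_def by blast+

lemma \<iota>_0 [simp]: "\<iota> 0 = 0"
  by (rule add_left_imp_eq[of "\<iota> 0"]) (simp only: add_0_right flip: \<iota>_add)

lemma \<iota>_eq_0_iff [simp]: "\<iota> a = 0 \<longleftrightarrow> a = 0"
proof
  assume "\<iota> a = 0"
  show "a = 0"
  proof (rule ccontr)
    assume "a \<noteq> 0"
    hence "\<iota> (a * inverse a) = 1" by simp
    thus False using \<open>\<iota> a = 0\<close> by (simp only: \<iota>_mult) simp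
  qed
qed simp

lemma \<iota>_minus: "\<iota> (- a) = - \<iota> a"
  using \<iota>_add[of a "-a"] by (simp add: eq_neg_iff_add_eq_0 add.commute)

lemma \<iota>_diff: "\<iota> (a - b) = \<iota> a - \<iota> b"
  using \<iota>_add[of a "-b"] by (simp add: \<iota>_minus)

lemma inj_\<iota>: "inj \<iota>"
  by (rule injI) (metis \<iota>_diff \<iota>_eq_0_iff eq_iff_diff_eq_0)

lemma \<iota>_sum: "\<iota> (sum f A) = (\<Sum>x\<in>A. \<iota> (f x))"
  by (induction A rule: infinite_finite_induct) (auto simp: \<iota>_add)

lemma \<iota>_power: "\<iota> (a ^ k) = \<iota> a ^ k"
  by (induction k) (auto simp: \<iota>_mult)

lemma coeff_J [simp]: "coeff (J A) i = \<iota> (coeff A i)"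
  by (simp add: coeff_map_poly)

lemma J_add: "J (A + B) = J A + J B"
  by (intro poly_eqI) (simp add: \<iota>_add)

lemma J_diff: "J (A - B) = J A - J B"
  by (intro poly_eqI) (simp add: \<iota>_diff)

lemma J_mult: "J (A * B) = J A * J B"
  by (intro poly_eqI) (simp add: coeff_mult \<iota>_sum \<iota>_mult)

lemma J_power: "J (A ^ k) = J A ^ k"
  by (induction k) (auto simp: J_mult)

lemma inj_J: "inj J"
proof (rule injI, rule poly_eqI)
  fix A B i assume "J A = J B"
  hence "coeff (J A) i = coeff (J B) i" by simp
  thus "coeff A i = coeff B i" using inj_\<iota> by (simp add: inj_eq)
qed

lemma J_eq_iff [simp]: "J A = J B \<longleftrightarrow> A = B"
  using inj_J by (rule inj_eq)

lemma J_eq_0_iff [simp]: "J A = 0 \<longleftrightarrow> A = 0"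
  using J_eq_iff[of A 0] by simp

lemma degree_J [simp]: "degree (J A) = degree A"
  by (rule degree_map_poly) simp

lemma monics_J_iff [simp]: "J A \<in> monics k \<longleftrightarrow> A \<in> monics k"
  using inj_eq[OF inj_\<iota>, of _ 1] by (auto simp: monics_def)

text \<open>\<open>J\<close> preserves degrees, so it carries a division with remainder to a
  division with remainder. Divisibility between images thereby comes back to the small
  field.\<close>

lemma J_div_mod: "J A div J B = J (A div B)" "J A mod J B = J (A mod B)"
proof -
  have "J A div J B = J (A div B) \<and> J A mod J B = J (A mod B)"
  proof (cases "B = 0")
    case False
    have "J A = J (A div B) * J B + J (A mod B)"
      by (simp flip: J_mult J_add)
    moreover have "J (A mod B) div J B = 0 \<and> J (A mod B) mod J B = J (A mod B)"
    proof (cases "A mod B = 0")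
      case nz: False
      hence "degree (J (A mod B)) < degree (J B)"
        using degree_mod_less[OF False, of A] by simp
      thus ?thesis using div_poly_less mod_poly_less by blast
    qed auto
    ultimately show ?thesis using False by simp
  qed auto
  thus "J A div J B = J (A div B)" "J A mod J B = J (A mod B)" by auto
qed

lemma J_dvd_iff [simp]: "J A dvd J B \<longleftrightarrow> A dvd B"
  unfolding dvd_eq_mod_eq_0 J_div_mod by (rule J_eq_0_iff)

lemma J_coprime_iff [simp]: "coprime (J A) (J B) \<longleftrightarrow> coprime A B"
proof
  assume *: "coprime (J A) (J B)"
  show "coprime A B"
  proof (rule coprimeI)
    fix D assume "D dvd A" "D dvd B"
    hence "J D dvd 1" using * by (metis J_dvd_iff coprime_common_divisor)
    thus "is_unit D" using J_dvd_iff[of D 1] by simp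
  qed
next
  assume "coprime A B"
  then obtain U V where "U * A + V * B = 1"
    by (metis bezout_coefficients_fst_snd coprime_iff_gcd_eq_1)
  hence *: "J U * J A + J V * J B = 1" by (simp flip: J_mult J_add)
  show "coprime (J A) (J B)"
    by (rule coprimeI) (metis * dvd_add dvd_mult)
qed

subsection \<open>Frobenius, trace and norm\<close>

text \<open>The identity \<open>(Y + 1) ^ q = Y ^ q + 1\<close> holds over the small field, is
  carried over by \<open>J\<close>, and is evaluated at \<open>y / x\<close>.\<close>

lemma frob_add: "(x + y :: 'b) ^ q = x ^ q + y ^ q"
proof (cases "x = 0")
  case False
  have "J ([:1, 1:] ^ q) = [:1, 1:] ^ q" by (simp add: J_power map_poly_pCons)
  hence "[:1, 1:] ^ q = monom 1 q + (1 :: 'b poly)"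
    by (simp add: q_def poly_plus_one_power_CARD J_add map_poly_monom)
  hence "poly ([:1, 1:] ^ q) (y / x) = poly (monom 1 q + (1 :: 'b poly)) (y / x)" by simp
  hence "(1 + y / x) ^ q = (y / x) ^ q + 1" by (simp add: poly_monom)
  moreover have "x + y = x * (1 + y / x)" using False by (simp add: field_simps)
  ultimately have "(x + y) ^ q = x ^ q * ((y / x) ^ q + 1)" by (simp only: power_mult_distrib)
  thus ?thesis using False by (simp add: field_simps)
qed (use q_gt_1 in auto)

lemma frob_sum: "(sum f A :: 'b) ^ q = (\<Sum>x\<in>A. f x ^ q)"
  by (induction A rule: infinite_finite_induct) (use q_gt_1 in \<open>auto simp: frob_add\<close>)

lemma coeff_\<sigma>: "coeff (\<sigma> A) i = coeff A i ^ q"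
  using q_gt_1 by (simp add: frob_poly_def coeff_map_poly)

lemma \<sigma>_0 [simp]: "\<sigma> 0 = 0"
  by (simp add: frob_poly_def)

lemma \<sigma>_1 [simp]: "\<sigma> 1 = 1"
  by (simp add: frob_poly_def)

lemma \<sigma>_add: "\<sigma> (A + B) = \<sigma> A + \<sigma> B"
  by (intro poly_eqI) (simp add: coeff_\<sigma> frob_add)

lemma \<sigma>_mult: "\<sigma> (A * B) = \<sigma> A * \<sigma> B"
  by (intro poly_eqI) (simp add: coeff_\<sigma> coeff_mult frob_sum power_mult_distrib)

lemma \<sigma>_sum: "\<sigma> (sum f A) = (\<Sum>x\<in>A. \<sigma> (f x))"
  by (induction A rule: infinite_finite_induct) (auto simp: \<sigma>_add)

lemma \<sigma>_prod: "\<sigma> (prod f A) = (\<Prod>x\<in>A. \<sigma> (f x))"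
  by (induction A rule: infinite_finite_induct) (auto simp: \<sigma>_mult)

lemma \<sigma>_J [simp]: "\<sigma> (J A) = J A"
  by (intro poly_eqI) (simp add: coeff_\<sigma> power_q flip: \<iota>_power)

lemma \<sigma>_pow_J [simp]: "(\<sigma> ^^ i) (J A) = J A"
  by (induction i) auto

lemma \<sigma>_pow_add: "(\<sigma> ^^ i) (A + B) = (\<sigma> ^^ i) A + (\<sigma> ^^ i) B"
  by (induction i) (auto simp: \<sigma>_add)

lemma \<sigma>_pow_1 [simp]: "(\<sigma> ^^ i) 1 = 1"
  by (induction i) auto

lemma \<sigma>_pow_mult: "(\<sigma> ^^ i) (A * B) = (\<sigma> ^^ i) A * (\<sigma> ^^ i) B"
  by (induction i) (auto simp: \<sigma>_mult)

lemma \<sigma>_pow_diff: "(\<sigma> ^^ i) (A - B) = (\<sigma> ^^ i) A - (\<sigma> ^^ i) B"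
  using \<sigma>_pow_add[of i "A - B" B] by simp

lemma coeff_\<sigma>_pow: "coeff ((\<sigma> ^^ i) A) j = coeff A j ^ (q ^ i)"
  by (induction i) (simp_all add: coeff_\<sigma> mult.commute flip: power_mult)

lemma \<sigma>_pow_n [simp]: "(\<sigma> ^^ n) A = A"
  by (rule poly_eqI) (simp add: coeff_\<sigma>_pow power_q_n)

lemma monics_\<sigma>_pow: "A \<in> monics k \<Longrightarrow> (\<sigma> ^^ i) A \<in> monics k"
proof -
  have "degree ((\<sigma> ^^ i) A) = degree A"
    by (rule degree_cong) (use q_gt_1 in \<open>auto simp: coeff_\<sigma>_pow\<close>)
  thus "A \<in> monics k \<Longrightarrow> (\<sigma> ^^ i) A \<in> monics k"
    by (auto simp: monics_def coeff_\<sigma>_pow)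
qed

text \<open>\<open>Y ^ q - Y\<close> has at most \<open>q\<close> roots, and the image of
  \<open>\<iota>\<close> already provides \<open>q\<close> of them.\<close>

lemma frob_fixed_imp_range:
  assumes "x ^ q = (x :: 'b)"
  shows   "x \<in> range \<iota>"
proof -
  define p where "p = (monom 1 q - monom 1 1 :: 'b poly)"
  have "coeff p q = 1" using q_gt_1 by (auto simp: p_def)
  hence nz: "p \<noteq> 0" by auto
  have "degree p \<le> q" unfolding p_def
    by (intro degree_diff_le) (use q_gt_1 in \<open>auto simp: degree_monom_eq\<close>)
  hence "card {x. poly p x = 0} \<le> q" using card_poly_roots_bound[OF nz] by simp
  moreover have "range \<iota> \<subseteq> {x. poly p x = 0}"
    by (auto simp: p_def poly_monom power_q simp flip: \<iota>_power)
  moreover have "card (range \<iota>) = q" using inj_\<iota> by (simp add: card_image q_def)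
  ultimately have "range \<iota> = {x. poly p x = 0}"
    by (intro card_seteq) auto
  thus ?thesis using assms by (simp add: p_def poly_monom)
qed

lemma \<sigma>_fixed_imp_range:
  assumes "\<sigma> A = A"
  shows   "A \<in> range J"
proof -
  have "coeff A i \<in> range \<iota>" for i
    using coeff_\<sigma>[of A i] assms by (intro frob_fixed_imp_range) simp
  hence *: "\<iota> (inv \<iota> (coeff A i)) = coeff A i" for i by (simp add: f_inv_into_f)
  have "inv \<iota> 0 = 0" using inv_f_f[OF inj_\<iota>, of 0] by simp
  hence "A = J (map_poly (inv \<iota>) A)"
    by (intro poly_eqI) (simp add: coeff_map_poly *)
  thus ?thesis by blast
qed

definition "TR A = inv J (tr_poly q n A)"

definition "NM A = inv J (norm_poly q n A)"

text \<open>Applying \<open>\<sigma>\<close> shifts the indices \<open>1..n\<close> to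
  \<open>2..n+1\<close>, and the last one returns to 1 because \<open>\<sigma> ^^ n\<close> is the
  identity.\<close>

lemma \<sigma>_tr_poly: "\<sigma> (tr_poly q n A) = tr_poly q n A"
  and \<sigma>_norm_poly: "\<sigma> (norm_poly q n A) = norm_poly q n A"
proof -
  have "\<sigma> (tr_poly q n A) = (\<Sum>i=1..n. (\<sigma> ^^ Suc i) A)"
    by (simp add: tr_poly_def \<sigma>_sum)
  also have "\<dots> = (\<Sum>i=Suc 1..Suc n. (\<sigma> ^^ i) A)"
    by (rule sum.shift_bounds_cl_Suc_ivl [symmetric])
  also have "\<dots> = (\<Sum>i=1..n. (\<sigma> ^^ i) A)"
    using n by (simp add: sum.atLeast_Suc_atMost[of "Suc 0" n] add.commute)
  finally show "\<sigma> (tr_poly q n A) = tr_poly q n A" by (simp add: tr_poly_def)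
  have "\<sigma> (norm_poly q n A) = (\<Prod>i=1..n. (\<sigma> ^^ Suc i) A)"
    by (simp add: norm_poly_def \<sigma>_prod)
  also have "\<dots> = (\<Prod>i=Suc 1..Suc n. (\<sigma> ^^ i) A)"
    by (rule prod.shift_bounds_cl_Suc_ivl [symmetric])
  also have "\<dots> = (\<Prod>i=1..n. (\<sigma> ^^ i) A)"
    using n by (simp add: prod.atLeast_Suc_atMost[of "Suc 0" n] mult.commute)
  finally show "\<sigma> (norm_poly q n A) = norm_poly q n A" by (simp add: norm_poly_def)
qed

lemma J_TR: "J (TR A) = (\<Sum>i=1..n. (\<sigma> ^^ i) A)"
  unfolding TR_def using f_inv_into_f[OF \<sigma>_fixed_imp_range[OF \<sigma>_tr_poly]] by (simp add: tr_poly_def)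

lemma J_NM: "J (NM A) = (\<Prod>i=1..n. (\<sigma> ^^ i) A)"
  unfolding NM_def using f_inv_into_f[OF \<sigma>_fixed_imp_range[OF \<sigma>_norm_poly]] by (simp add: norm_poly_def)

lemma TR_add: "TR (A + B) = TR A + TR B"
  by (simp add: J_TR J_add \<sigma>_pow_add sum.distrib flip: J_eq_iff)

lemma TR_J_mult: "TR (J C * A) = C * TR A"
  by (simp add: J_TR J_mult \<sigma>_pow_mult sum_distrib_left flip: J_eq_iff)

lemma TR_J: "TR (J C) = of_nat n * C"
proof -
  have "J (of_nat k) = of_nat k" for k by (induction k) (auto simp: J_add)
  thus ?thesis by (simp add: J_TR J_mult flip: J_eq_iff)
qed

lemma NM_mult: "NM (A * B) = NM A * NM B"
  by (simp add: J_NM J_mult \<sigma>_pow_mult prod.distrib flip: J_eq_iff)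

lemma NM_1 [simp]: "NM 1 = 1"
  by (simp add: J_NM flip: J_eq_iff)

lemma NM_J: "NM (J C) = C ^ n"
  by (simp add: J_NM J_power flip: J_eq_iff)

lemma monics_NM: "A \<in> monics k \<Longrightarrow> NM A \<in> monics (n * k)"
proof -
  assume "A \<in> monics k"
  hence "J (NM A) \<in> monics (n * k)"
    unfolding J_NM using monics_prod[of "{1..n}" "\<lambda>i. (\<sigma> ^^ i) A" k] monics_\<sigma>_pow by simp
  thus ?thesis by simp
qed

text \<open>The conjugate with index \<open>n\<close> is \<open>A\<close> itself.\<close>

lemma dvd_J_NM: "A dvd J (NM A)"
proof -
  have "(\<sigma> ^^ n) A dvd (\<Prod>i=1..n. (\<sigma> ^^ i) A)"
    by (rule dvd_prodI) (use n in auto)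
  thus ?thesis by (simp add: J_NM)
qed

lemma \<sigma>_pow_dvd: "A dvd B \<Longrightarrow> (\<sigma> ^^ i) A dvd (\<sigma> ^^ i) B"
  by (elim dvdE) (simp add: \<sigma>_pow_mult)

lemma TR_cong: "J H dvd A - B \<Longrightarrow> H dvd TR A - TR B"
proof -
  assume *: "J H dvd A - B"
  have "J H dvd (\<Sum>i=1..n. (\<sigma> ^^ i) (A - B))"
    by (rule dvd_sum) (use \<sigma>_pow_dvd[OF *] in auto)
  hence "J H dvd J (TR A - TR B)"
    by (simp add: J_TR J_diff \<sigma>_pow_diff sum_subtractf)
  thus ?thesis by (simp only: J_dvd_iff)
qed

lemma NM_cong: "J H dvd A - B \<Longrightarrow> H dvd NM A - NM B"
proof -
  assume *: "J H dvd A - B"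
  have "(\<sigma> ^^ i) A mod J H = (\<sigma> ^^ i) B mod J H" for i
    using \<sigma>_pow_dvd[OF *, of i] by (simp add: \<sigma>_pow_diff mod_eq_dvd_iff)
  hence "J (NM A) mod J H = J (NM B) mod J H"
    unfolding J_NM by (subst (1 2) mod_prod_eq [symmetric]) simp
  thus ?thesis by (simp add: J_div_mod mod_eq_dvd_iff)
qed

lemma coprime_NM_iff: "coprime (NM A) H \<longleftrightarrow> coprime A (J H)"
proof
  assume "coprime (NM A) H"
  hence "coprime (J (NM A)) (J H)" by simp
  thus "coprime A (J H)" using coprime_divisors[OF dvd_J_NM dvd_refl] by blast
next
  assume *: "coprime A (J H)"
  then obtain U V where UV: "U * A + V * J H = 1"
    by (metis bezout_coefficients_fst_snd coprime_iff_gcd_eq_1)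
  have "coprime ((\<sigma> ^^ i) A) (J H)" for i
  proof (rule coprimeI)
    fix D assume D: "D dvd (\<sigma> ^^ i) A" "D dvd J H"
    \<comment> \<open>\<open>\<sigma>\<close> fixes \<open>J H\<close>, so a Bezout relation for
      \<open>A\<close> and \<open>J H\<close> turns into one for each conjugate.\<close>
    have "(\<sigma> ^^ i) (U * A + V * J H) = 1" by (simp add: UV)
    thus "is_unit D" using D by (simp add: \<sigma>_pow_add \<sigma>_pow_mult) (metis dvd_add dvd_mult)
  qed
  hence "coprime (J (NM A)) (J H)" unfolding J_NM by (intro prod_coprime_left) auto
  thus "coprime (NM A) H" by simp
qed

lemma prod_one_plus_mod_square:
  fixes M :: "'b poly"
  shows "finite I \<Longrightarrow> M ^ 2 dvd (\<Prod>i\<in>I. 1 + M * f i) - (1 + M * (\<Sum>i\<in>I. f i))"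
proof (induction I rule: finite_induct)
  case (insert x I)
  obtain R where "(\<Prod>i\<in>I. 1 + M * f i) - (1 + M * (\<Sum>i\<in>I. f i)) = M ^ 2 * R"
    using insert.IH by (elim dvdE)
  hence R: "(\<Prod>i\<in>I. 1 + M * f i) = 1 + M * (\<Sum>i\<in>I. f i) + M ^ 2 * R"
    by (simp add: diff_eq_eq add.commute)
  have "(\<Prod>i\<in>insert x I. 1 + M * f i) - (1 + M * (\<Sum>i\<in>insert x I. f i))
      = M ^ 2 * (f x * (\<Sum>i\<in>I. f i) + (1 + M * f x) * R)"
    using insert.hyps by (simp add: R algebra_simps power2_eq_square)
  thus ?case by simp
qed auto

lemma NM_one_plus: "M ^ 2 dvd NM (1 + J M * A) - (1 + M * TR A)"
proof -
  have "J M ^ 2 dvd (\<Prod>i=1..n. 1 + J M * (\<sigma> ^^ i) A) - (1 + J M * (\<Sum>i=1..n. (\<sigma> ^^ i) A))"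
    by (rule prod_one_plus_mod_square) auto
  hence "J (M ^ 2) dvd J (NM (1 + J M * A) - (1 + M * TR A))"
    by (simp add: J_NM J_TR J_diff J_add J_mult J_power \<sigma>_pow_add \<sigma>_pow_mult)
  thus ?thesis by (simp only: J_dvd_iff)
qed

text \<open>
  The trace of a constant, as a polynomial function of degree \<open>q\<^sup>n\<^sup>-\<^sup>1\<close> on the large field, is not zero.
\<close>
lemma TR_surj: "\<exists>B. TR B = C"
proof -
  define p where "p = (\<Sum>i<n. monom 1 (q ^ i) :: 'b poly)"
  have "coeff p (q ^ (n - 1)) = (\<Sum>i<n. if i = n - 1 then 1 else 0)"
    unfolding p_def coeff_sum using q_gt_1 by (intro sum.cong) auto
  hence "coeff p (q ^ (n - 1)) = 1" using n by simp
  hence nz: "p \<noteq> 0" by auto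
  have "degree p \<le> q ^ (n - 1)"
    unfolding p_def
    by (intro degree_sum_le) (use q_gt_1 in \<open>auto simp: degree_monom_eq intro!: power_increasing\<close>)
  also have "\<dots> < q ^ n" using n q_gt_1 by (intro power_strict_increasing) auto
  finally have "card {x. poly p x = 0} < CARD('b)"
    using card_poly_roots_bound[OF nz] card_ext by simp
  then obtain x where x: "poly p x \<noteq> 0" by (metis (mono_tags) UNIV_eq_I less_irrefl mem_Collect_eq)
  have "J (TR [:x:]) = [:poly p x:]"
  proof (rule poly_eqI)
    fix j
    \<comment> \<open>The ranges differ in the indices \<open>n\<close> and 0, whose terms
      agree.\<close>
    have "(\<Sum>i=1..n. x ^ q ^ i) = (\<Sum>i<n. x ^ q ^ i)"
    proof -
      have "(\<Sum>i=1..n. x ^ q ^ i) + x ^ q ^ 0 = (\<Sum>i\<le>n. x ^ q ^ i)"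
        by (simp add: sum.atLeast_Suc_atMost atMost_atLeast0 add.commute)
      also have "\<dots> = (\<Sum>i<n. x ^ q ^ i) + x ^ q ^ n"
        by (simp flip: lessThan_Suc_atMost)
      finally show ?thesis by (simp add: power_q_n)
    qed
    thus "coeff (J (TR [:x:])) j = coeff [:poly p x:] j"
      unfolding J_TR coeff_sum coeff_\<sigma>_pow
      using q_gt_1 by (cases j) (auto simp: p_def poly_sum poly_monom power_0_left)
  qed
  hence "degree (TR [:x:]) = 0" "TR [:x:] \<noteq> 0" using x degree_J[of "TR [:x:]"] by auto
  then obtain c where c: "TR [:x:] = [:c:]" "c \<noteq> 0" by (metis degree_eq_zeroE pCons_0_0)
  \<comment> \<open>\<open>TR\<close> is linear over the small polynomial ring, so one constant of
    nonzero trace is enough.\<close>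
  have "TR (J (smult (1 / c) C) * [:x:]) = C" unfolding TR_J_mult c(1) using c(2) by simp
  thus ?thesis by blast
qed

end

subsection \<open>Lifting characters through the norm\<close>

lemma fps_char_coeff_deriv:
  fixes f :: "'c::{field_gcd,finite} poly \<Rightarrow> complex"
  assumes "monic_char f"
  shows "fps_X * fps_deriv (Abs_fps (char_coeff f)) = Abs_fps (char_pow_sum f) * Abs_fps (char_coeff f)"
proof (rule fps_ext)
  fix k
  have 0: "char_pow_sum f 0 = 0" by (simp add: char_pow_sum_def)
  have "fps_nth (fps_X * fps_deriv (Abs_fps (char_coeff f))) k = of_nat k * char_coeff f k"
    by (cases k) auto
  also have "\<dots> = (\<Sum>j=0..k. char_pow_sum f j * char_coeff f (k - j))"
    unfolding char_coeff_recurrence[OF assms] by (subst (2) sum.atLeast_Suc_atMost) (auto simp: 0)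
  finally show "fps_nth (fps_X * fps_deriv (Abs_fps (char_coeff f))) k =
      fps_nth (Abs_fps (char_pow_sum f) * Abs_fps (char_coeff f)) k"
    by (simp add: fps_mult_nth)
qed

lemma char_coeff_0: "monic_char f \<Longrightarrow> char_coeff f 0 = 1"
  by (simp add: char_coeff_def monics_0 monic_char_def)

text \<open>For the constant character 1, coefficient \<open>k\<close> is
  \<open>CARD('c) ^ k\<close>, and the recurrence then forces the power sums to be the same
  powers.\<close>

lemma sum_degree_prime_pows:
  assumes "k > 0"
  shows   "(\<Sum>(P, i)\<in>prime_pows k. degree (P :: 'c::{field_gcd,finite} poly)) = CARD('c) ^ k"
proof -
  let ?f = "\<lambda>_ :: 'c poly. 1 :: complex"
  have f: "monic_char ?f" by (simp add: monic_char_def)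
  have a: "char_coeff ?f k = of_nat CARD('c) ^ k" for k
    by (simp add: char_coeff_def card_monics)
  have "char_pow_sum ?f k = of_nat CARD('c) ^ k" using assms
  proof (induction k rule: less_induct)
    case (less k)
    have "of_nat k * of_nat CARD('c) ^ k
        = (\<Sum>j=1..k. char_pow_sum ?f j * of_nat CARD('c) ^ (k - j))"
      using char_coeff_recurrence[OF f, of k] by (simp add: a)
    also have "{1..k} = insert k {1..<k}" using less.prems by auto
    also have "(\<Sum>j\<in>\<dots>. char_pow_sum ?f j * of_nat CARD('c) ^ (k - j))
        = char_pow_sum ?f k + (\<Sum>j=1..<k. char_pow_sum ?f j * of_nat CARD('c) ^ (k - j))"
      by simp
    also have "(\<Sum>j=1..<k. char_pow_sum ?f j * of_nat CARD('c) ^ (k - j))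
        = (\<Sum>j=1..<k. of_nat CARD('c) ^ k)"
      by (intro sum.cong refl) (simp add: less.IH flip: power_add)
    also have "\<dots> = (of_nat k - 1) * of_nat CARD('c) ^ k"
      using less.prems by (simp add: of_nat_diff)
    finally show ?case by (simp add: algebra_simps)
  qed
  hence "complex_of_nat (\<Sum>(P, i)\<in>prime_pows k. degree (P :: 'c poly)) = of_nat (CARD('c) ^ k)"
    by (simp add: char_pow_sum_def case_prod_unfold)
  thus ?thesis by (simp only: of_nat_eq_iff)
qed

lemma prod_primes_dvd:
  fixes a :: "'c::field_gcd poly"
  assumes "finite S" "\<And>p. p \<in> S \<Longrightarrow> prime p" "\<And>p. p \<in> S \<Longrightarrow> p dvd a"
  shows   "\<Prod>S dvd a"
  using assms
proof (induction S rule: finite_induct)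
  case (insert p S)
  have "coprime p (\<Prod>S)"
    using insert by (intro prod_coprime_right primes_coprime) auto
  thus ?case using insert by (auto intro: divides_mult)
qed auto

section \<open>Primes over the large field and the primes below them\<close>

context finite_field_ext
begin

text \<open>A prime \<open>R\<close> over \<open>P\<close> divides some conjugate of
  \<open>Q\<close>. Undoing the conjugation gives a nonunit dividing \<open>Q\<close>, hence an
  associate of \<open>Q\<close>, and it still divides \<open>J P\<close>, which
  \<open>\<sigma>\<close> fixes.\<close>

lemma prime_dvd_J_if_dvd_NM:
  assumes Q: "prime Q" and P: "prime P" "P dvd NM Q"
  shows   "Q dvd J P"
proof -
  have nz: "J P \<noteq> 0" using P by auto
  moreover from this have "\<not> is_unit (J P)"
    using prime_poly_monic(2)[OF P(1)] by (simp add: is_unit_iff_degree)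
  ultimately obtain R where R: "prime R" "R dvd J P" using prime_divisor_exists by blast
  have "R dvd J (NM Q)" using R(2) P(2) dvd_trans J_dvd_iff by blast
  then obtain i where i: "i \<in> {1..n}" "R dvd (\<sigma> ^^ i) Q"
    unfolding J_NM using R(1) by (auto simp: prime_dvd_prod_iff)
  let ?R = "(\<sigma> ^^ (n - i)) R"
  have "?R dvd (\<sigma> ^^ (n - i)) ((\<sigma> ^^ i) Q)" by (rule \<sigma>_pow_dvd[OF i(2)])
  also have "(\<sigma> ^^ (n - i)) ((\<sigma> ^^ i) Q) = (\<sigma> ^^ (n - i + i)) Q" by (simp only: funpow_add o_apply)
  also have "\<dots> = Q" using i(1) by simp
  finally have "?R dvd Q" .
  moreover have "?R \<in> monics (degree R)" by (rule monics_\<sigma>_pow[OF prime_poly_monic(1)[OF R(1)]])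
  hence "\<not> is_unit ?R"
    using prime_poly_monic(2)[OF R(1)] monics_nonzero is_unit_iff_degree[of ?R]
    by (auto simp: monics_def)
  ultimately have "Q dvd ?R"
    using Q irreducibleD' prime_elem_imp_irreducible prime_imp_prime_elem by blast
  also have "?R dvd (\<sigma> ^^ (n - i)) (J P)" by (rule \<sigma>_pow_dvd[OF R(2)])
  finally show ?thesis by simp
qed

text \<open>Two distinct primes dividing \<open>NM Q\<close> would have coprime images under
  \<open>J\<close>, yet both images are divisible by \<open>Q\<close>.\<close>

lemma NM_prime:
  assumes Q: "prime Q"
  obtains P e where "prime P" "NM Q = P ^ e"
proof -
  have m: "NM Q \<in> monics (n * degree Q)" by (rule monics_NM[OF prime_poly_monic(1)[OF Q]])
  have "degree (NM Q) > 0" using m n prime_poly_monic(2)[OF Q] by (simp add: monics_def)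
  moreover from this have "NM Q \<noteq> 0" by auto
  ultimately have "\<not> is_unit (NM Q)" by (simp add: is_unit_iff_degree)
  then obtain P where P: "prime P" "P dvd NM Q"
    using \<open>NM Q \<noteq> 0\<close> prime_divisor_exists by blast
  have "P' = P" if P': "prime P'" "P' dvd NM Q" for P'
  proof (rule ccontr)
    assume "P' \<noteq> P"
    hence "coprime (J P') (J P)" using P P' primes_coprime by simp
    thus False
      using prime_dvd_J_if_dvd_NM[OF Q P] prime_dvd_J_if_dvd_NM[OF Q P'] Q
      by (metis coprime_common_divisor not_prime_unit)
  qed
  hence "prime_factors (NM Q) = {P}"
    unfolding set_eq_iff in_prime_factors_iff using P \<open>NM Q \<noteq> 0\<close> by blast
  hence "NM Q = P ^ multiplicity P (NM Q)"
    using prod_prime_factors[OF \<open>NM Q \<noteq> 0\<close>] normalize_monic[OF m] by simp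
  thus ?thesis using that P(1) by blast
qed

text \<open>
  Write \<open>NM Q = P\<^sup>e\<close> and group the pairs \<open>(Q, i)\<close> by \<open>(P, e i)\<close>. The primes \<open>Q\<close> above a fixed
  \<open>P\<close> have degrees adding up to at most \<open>degree P\<close>. Equality is forced because the total degrees on
  the two sides, \<open>CARD('b)\<^sup>k\<close> and \<open>q\<^sup>n\<^sup>k\<close>, agree.
\<close>
lemma char_pow_sum_NM:
  fixes f :: "'a poly \<Rightarrow> complex"
  assumes f: "monic_char f" and k: "k > 0"
  shows   "char_pow_sum (\<lambda>B. f (NM B)) k = char_pow_sum f (n * k)"
proof -
  have "\<exists>P e. prime P \<and> NM Q = P ^ e" if "prime Q" for Q
    using NM_prime[OF that] by metis
  then obtain pr ex where pe: "\<And>Q. prime Q \<Longrightarrow> prime (pr Q) \<and> NM Q = pr Q ^ ex Q"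
    by metis
  define h where "h = (\<lambda>(Q, i :: nat). (pr Q, ex Q * i))"
  have h_in: "h ` prime_pows k \<subseteq> prime_pows (n * k)"
  proof
    fix y assume "y \<in> h ` prime_pows k"
    then obtain Q i where Qi: "(Q, i) \<in> prime_pows k" "y = h (Q, i)" by auto
    hence Q: "prime Q" "i * degree Q = k" by (auto simp: prime_pows_def)
    have "degree (NM Q) = n * degree Q"
      using monics_NM[OF prime_poly_monic(1)[OF Q(1)]] by (simp add: monics_def)
    moreover have "degree (NM Q) = ex Q * degree (pr Q)"
      using pe[OF Q(1)] by (auto simp: degree_power_eq)
    ultimately have "ex Q * i * degree (pr Q) = n * k" using Q(2) by (auto simp: algebra_simps)
    moreover from this have "ex Q * i \<noteq> 0" using n k by (metis mult_is_0 not_one_le_zero less_irrefl)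
    ultimately show "y \<in> prime_pows (n * k)"
      using pe[OF Q(1)] unfolding Qi(2) by (auto simp: h_def prime_pows_def)
  qed
  define c where "c y = (\<Sum>x | x \<in> prime_pows k \<and> h x = y. degree (fst x))" for y
  have "c y \<le> degree (fst y)" if y: "y \<in> prime_pows (n * k)" for y
  proof -
    define X where "X = {x \<in> prime_pows k. h x = y}"
    have "finite X" by (simp add: X_def)
    have X: "prime Q" "i * degree Q = k" "h (Q, i) = y" if "(Q, i) \<in> X" for Q i
      using that by (auto simp: X_def prime_pows_def)
    \<comment> \<open>In a pair from \<open>X\<close> the exponent is determined by
      \<open>i * degree Q = k\<close>, so the sum runs over distinct primes \<open>Q\<close>, whose
      product divides \<open>J (fst y)\<close>.\<close>
    have "inj_on fst X"
    proof (rule inj_onI)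
      fix x x' assume x: "x \<in> X" "x' \<in> X" "fst x = fst x'"
      obtain Q i i' where [simp]: "x = (Q, i)" "x' = (Q, i')"
        using x(3) by (metis prod.collapse)
      have "i * degree Q = i' * degree Q" using X(2)[of Q i] X(2)[of Q i'] x by simp
      thus "x = x'" using prime_poly_monic(2)[OF X(1)[of Q i]] x(1) by simp
    qed
    hence "c y = (\<Sum>Q\<in>fst ` X. degree Q)"
      unfolding c_def X_def[symmetric] by (simp add: sum.reindex)
    also have "\<dots> = degree (\<Prod>(fst ` X))"
      using X(1) by (subst degree_prod_eq_sum_degree) (auto dest!: X(1))
    also have "\<dots> \<le> degree (J (fst y))"
    proof (rule dvd_imp_degree_le)
      show "J (fst y) \<noteq> 0" using y by (auto simp: prime_pows_def)
      show "\<Prod>(fst ` X) dvd J (fst y)"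
      proof (rule prod_primes_dvd)
        fix Q assume "Q \<in> fst ` X"
        then obtain i where Qi: "(Q, i) \<in> X" by auto
        show "prime Q" by (rule X(1)[OF Qi])
        have "Q dvd J (NM Q)" by (rule dvd_J_NM)
        hence "Q dvd J (fst y) ^ ex Q"
          using pe[OF X(1)[OF Qi]] X(3)[OF Qi] by (auto simp: h_def J_power)
        thus "Q dvd J (fst y)" using prime_dvd_power[OF X(1)[OF Qi]] by blast
      qed (use \<open>finite X\<close> in auto)
    qed
    finally show ?thesis by simp
  qed
  moreover have "(\<Sum>y\<in>prime_pows (n * k). c y) = (\<Sum>y\<in>prime_pows (n * k). degree (fst y :: 'a poly))"
  proof -
    have "(\<Sum>y\<in>prime_pows (n * k). c y) = (\<Sum>x\<in>prime_pows k. degree (fst x :: 'b poly))"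
      unfolding c_def by (rule sum.group) (use h_in in auto)
    also have "\<dots> = CARD('a) ^ (n * k)"
      using sum_degree_prime_pows[OF k, where 'c='b]
      by (simp add: case_prod_unfold card_ext q_def power_mult)
    also have "\<dots> = (\<Sum>y\<in>prime_pows (n * k). degree (fst y :: 'a poly))"
      using sum_degree_prime_pows[of "n * k", where 'c='a] n k by (simp add: case_prod_unfold)
    finally show ?thesis .
  qed
  ultimately have c: "c y = degree (fst y)" if "y \<in> prime_pows (n * k)" for y
    using sum_mono_inv[of c "prime_pows (n * k)" "\<lambda>y. degree (fst y)" y] that by simp

  have "char_pow_sum (\<lambda>B. f (NM B)) k
      = (\<Sum>x\<in>prime_pows k. of_nat (degree (fst x)) * f (NM (fst x)) ^ snd x)"
    by (simp add: char_pow_sum_def case_prod_unfold)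
  also have "\<dots> = (\<Sum>x\<in>prime_pows k. of_nat (degree (fst x)) * f (fst (h x)) ^ snd (h x))"
  proof (intro sum.cong refl)
    fix x :: "'b poly \<times> nat" assume x: "x \<in> prime_pows k"
    obtain Q i where [simp]: "x = (Q, i)" by (cases x)
    have "prime Q" using x by (simp add: prime_pows_def)
    hence "f (NM Q) = f (pr Q) ^ ex Q"
      using pe monic_char_power[OF f prime_poly_monic(1)[of "pr Q"]] by metis
    thus "of_nat (degree (fst x)) * f (NM (fst x)) ^ snd x
        = of_nat (degree (fst x)) * f (fst (h x)) ^ snd (h x)"
      by (simp add: h_def power_mult)
  qed
  also have "\<dots> = (\<Sum>y\<in>prime_pows (n * k). \<Sum>x | x \<in> prime_pows k \<and> h x = y.
                    of_nat (degree (fst x)) * f (fst (h x)) ^ snd (h x))"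
    by (rule sum.group [symmetric]) (use h_in in auto)
  also have "\<dots> = (\<Sum>y\<in>prime_pows (n * k). of_nat (c y) * f (fst y) ^ snd y)"
    by (simp add: c_def sum_distrib_right)
  also have "\<dots> = char_pow_sum f (n * k)"
    unfolding char_pow_sum_def case_prod_unfold by (intro sum.cong refl) (simp add: c)
  finally show ?thesis .
qed

text \<open>By \<open>char_pow_sum_NM\<close>, power sum \<open>k\<close> of the lift is power sum
  \<open>n * k\<close> of \<open>f\<close>, which is the relation between \<open>T\<close> and
  \<open>S\<close> in \<open>fps_log_deriv_power\<close>.\<close>

lemma char_coeff_NM:
  assumes f: "monic_char f" and m: "\<And>k. k > m \<Longrightarrow> char_coeff f k = 0"
  shows   "(-1) ^ m * char_coeff (\<lambda>B. f (NM B)) m = ((-1) ^ m * char_coeff f m) ^ n"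
proof -
  let ?g = "\<lambda>B. f (NM B)"
  have g: "monic_char ?g"
  proof -
    have "lead_coeff (NM A) = 1" if "lead_coeff A = 1" for A
      using monics_NM[of A "degree A"] that by (auto simp: monics_def)
    thus ?thesis using f unfolding monic_char_def by (simp add: NM_mult)
  qed
  have "(-1) ^ m * fps_nth (Abs_fps (char_coeff ?g)) m =
          ((-1) ^ m * fps_nth (Abs_fps (char_coeff f)) m) ^ n"
    by (rule fps_log_deriv_power[OF fps_char_coeff_deriv[OF f] _ _ fps_char_coeff_deriv[OF g]])
       (use f g m n in \<open>auto simp: char_coeff_0 char_pow_sum_NM[OF f]\<close>, simp add: char_pow_sum_def)
  thus ?thesis by simp
qed

end

subsection \<open>Residues and characters\<close>

lemma residues_mod_eq_polys_less:
  fixes H :: "'c::field poly"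
  assumes "H \<noteq> 0"
  shows   "residues_mod H = polys_less (degree H)"
proof (intro equalityI subsetI)
  fix D assume "D \<in> residues_mod H"
  thus "D \<in> polys_less (degree H)"
    using degree_mod_less[OF assms] by (auto simp: residues_mod_def polys_less_altdef)
next
  fix D :: "'c poly" assume "D \<in> polys_less (degree H)"
  hence "D mod H = D" by (auto simp: polys_less_altdef mod_poly_less)
  thus "D \<in> residues_mod H" unfolding residues_mod_def by (metis rangeI)
qed

lemma finite_residues_mod [simp]:
  "H \<noteq> 0 \<Longrightarrow> finite (residues_mod (H :: 'c::{field,finite} poly))"
  by (simp add: residues_mod_eq_polys_less finite_polys_less)

lemma residues_mod_iff: "D \<in> residues_mod H \<longleftrightarrow> D mod H = D"
  by (auto simp: residues_mod_def intro: range_eqI[OF sym])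

lemma mod_in_residues_mod [simp]: "D mod H \<in> residues_mod H"
  by (simp add: residues_mod_iff)

lemma coprime_poly_bezout:
  fixes A H :: "'c::field_gcd poly"
  assumes "coprime A H"
  obtains U where "H dvd U * A - 1" "coprime U H"
proof -
  obtain U V where UV: "U * A + V * H = 1"
    using assms by (metis bezout_coefficients_fst_snd coprime_iff_gcd_eq_1)
  hence "U * A - 1 = H * (- V)" by (simp add: algebra_simps eq_diff_eq)
  hence "H dvd U * A - 1" by simp
  moreover have "coprime U H"
    by (rule coprimeI) (metis UV dvd_add dvd_mult dvd_mult2)
  ultimately show ?thesis using that by blast
qed

lemma coprime_cong_dvd:
  fixes A B H :: "'c::field_gcd poly"
  assumes "H dvd A - B"
  shows   "coprime A H \<longleftrightarrow> coprime B H"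
proof -
  have "D dvd A \<longleftrightarrow> D dvd B" if "D dvd H" for D
    using dvd_add_right_iff[OF dvd_trans[OF that assms], of B] by simp
  thus ?thesis unfolding coprime_def by blast
qed

lemma mod_inverse_cancel:
  fixes H :: "'c::field poly"
  assumes "H dvd V * U - 1"
  shows   "(V * (U * D)) mod H = D mod H" "(U * (V * D)) mod H = D mod H"
proof -
  have "H dvd (V * U - 1) * D" using assms by simp
  thus "(V * (U * D)) mod H = D mod H" "(U * (V * D)) mod H = D mod H"
    by (simp_all add: mod_eq_dvd_iff algebra_simps)
qed

lemma sum_residues_mult_unit:
  fixes f :: "'c::{field_gcd,finite} poly \<Rightarrow> complex"
  assumes H: "H \<noteq> 0" and U: "coprime U H" and f: "\<And>A B. H dvd A - B \<Longrightarrow> f A = f B"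
  shows   "(\<Sum>D\<in>residues_mod H. f (U * D)) = (\<Sum>D\<in>residues_mod H. f D)"
proof -
  obtain V where V: "H dvd V * U - 1" using coprime_poly_bezout[OF U] by blast
  note VU = mod_inverse_cancel[OF V]
  have "bij_betw (\<lambda>D. (U * D) mod H) (residues_mod H) (residues_mod H)"
    by (rule bij_betwI[where g = "\<lambda>D. (V * D) mod H"])
       (auto simp: mod_mult_right_eq VU, auto simp: residues_mod_iff)
  hence "(\<Sum>D\<in>residues_mod H. f D) = (\<Sum>D\<in>residues_mod H. f ((U * D) mod H))"
    by (rule sum.reindex_bij_betw [symmetric])
  also have "\<dots> = (\<Sum>D\<in>residues_mod H. f (U * D))"
    by (intro sum.cong refl f) (simp flip: mod_eq_dvd_iff)
  finally show ?thesis by simp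
qed

lemma mult_char_mod_cong: "mult_char_mod H \<chi> \<Longrightarrow> H dvd A - B \<Longrightarrow> \<chi> A = \<chi> B"
  by (simp add: mult_char_mod_def)

lemma mult_char_mod_mult:
  fixes H :: "'c::field_gcd poly"
  assumes "mult_char_mod H \<chi>"
  shows   "\<chi> (A * B) = \<chi> A * \<chi> B"
proof (cases "coprime A H \<and> coprime B H")
  case False
  hence "\<not> coprime (A * B) H" by auto
  thus ?thesis using False assms by (auto simp: mult_char_mod_def)
qed (use assms in \<open>simp add: mult_char_mod_def\<close>)

lemma mult_char_mod_1: "mult_char_mod H \<chi> \<Longrightarrow> \<chi> 1 = 1"
  by (simp add: mult_char_mod_def)

lemma mult_char_mod_power:
  fixes H :: "'c::field_gcd poly"
  assumes "mult_char_mod H \<chi>"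
  shows   "\<chi> (A ^ k) = \<chi> A ^ k"
  by (induction k) (auto simp: mult_char_mod_mult[OF assms] mult_char_mod_1[OF assms])

lemma additive_char_add: "additive_char f \<Longrightarrow> f (a + b) = f a * f b"
  and additive_char_0: "additive_char f \<Longrightarrow> f 0 = 1"
  by (simp_all add: additive_char_def)

lemma additive_char_nonzero:
  assumes "additive_char f"
  shows   "f a \<noteq> 0"
proof -
  have "f a * f (- a) = 1" using assms unfolding additive_char_def by (metis add.right_inverse)
  thus ?thesis by auto
qed

lemma additive_char_of_nat_mult:
  assumes "additive_char f"
  shows   "f (of_nat k * (a :: 'c::ring_1)) = f a ^ k"
  by (induction k) (auto simp: additive_char_0[OF assms] additive_char_add[OF assms] algebra_simps)

lemma top_coeff_mod_cong:
  assumes "H dvd A - B"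
  shows   "top_coeff_mod H A = top_coeff_mod H B"
  using assms by (simp add: top_coeff_mod_def flip: mod_eq_dvd_iff)

subsection \<open>The second coefficient\<close>

text \<open>For monic \<open>F\<close> of positive degree this is minus the sum of the roots, which
  explains why products go to sums. The default 0 on constants gives the polynomial 1 the value that
  this rule demands.\<close>

definition second_coeff :: "'c::zero poly \<Rightarrow> 'c" where
  "second_coeff F = (if degree F = 0 then 0 else coeff F (degree F - 1))"

lemma second_coeff_mult:
  assumes F: "F \<in> monics k" and G: "G \<in> monics l"
  shows   "second_coeff (F * G) = second_coeff F + second_coeff G"
proof (cases "k = 0 \<or> l = 0")
  case True
  hence "F = 1 \<or> G = 1" using assms monics_0 by auto
  thus ?thesis by (auto simp: second_coeff_def)
next
  case False
  \<comment> \<open>Only the two top terms of \<open>F\<close> reach degree \<open>k + l - 1\<close>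
    in \<open>F * G\<close>; the rest \<open>R\<close> stays below.\<close>
  define R where "R = F - monom 1 k - monom (coeff F (k - 1)) (k - 1)"
  have R: "R \<in> polys_less (k - 1)"
    using F False by (auto simp: R_def polys_less_def monics_def coeff_eq_0)
  have "coeff (R * G) (k + l - 1) = 0"
  proof (cases "R = 0")
    case nz: False
    have "degree R < k - 1" using R nz by (auto simp: polys_less_altdef)
    hence "degree (R * G) < k + l - 1"
      using G degree_mult_le[of R G] False by (auto simp: monics_def)
    thus ?thesis by (rule coeff_eq_0)
  qed auto
  moreover have "F = monom 1 k + monom (coeff F (k - 1)) (k - 1) + R" by (simp add: R_def)
  ultimately have "coeff (F * G) (k + l - 1)
      = coeff (monom 1 k * G) (k + l - 1) + coeff (monom (coeff F (k - 1)) (k - 1) * G) (k + l - 1)"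
    by (metis (no_types, lifting) add.right_neutral coeff_add distrib_right)
  also have "\<dots> = coeff G (l - 1) + coeff F (k - 1) * coeff G l"
    using False by (auto simp: coeff_monom_mult)
  finally show ?thesis
    using monics_mult[OF F G] F G False by (auto simp: second_coeff_def monics_def)
qed

lemma second_coeff_prod:
  assumes "\<And>x. x \<in> A \<Longrightarrow> f x \<in> monics k"
  shows   "second_coeff (prod f A) = (\<Sum>x\<in>A. second_coeff (f x))"
  using assms
proof (induction A rule: infinite_finite_induct)
  case (insert x A)
  have "second_coeff (f x * prod f A) = second_coeff (f x) + second_coeff (prod f A)"
    by (rule second_coeff_mult[OF _ monics_prod]) (use insert.prems in auto)
  thus ?case using insert by simp
qed (auto simp: second_coeff_def)

lemma second_coeff_add:
  assumes F: "F \<in> monics k" and D: "D \<in> polys_less k" and k: "k > 0"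
  shows   "second_coeff (F + D) = second_coeff F + coeff D (k - 1)"
  using monics_add_polys_less[OF F D] F k by (simp add: second_coeff_def monics_def)

subsection \<open>Gauss sums as coefficients\<close>

text \<open>Adding \<open>H0\<close> makes a residue monic of degree \<open>degree H\<close> and
  does not change its class modulo \<open>H\<close>.\<close>

lemma monic_multiple:
  fixes H :: "'c::field poly"
  assumes "H \<noteq> 0"
  obtains H0 where "H0 \<in> monics (degree H)" "H dvd H0" "H0 dvd H"
proof -
  have "smult (inverse (lead_coeff H)) H \<in> monics (degree H)"
    using assms by (simp add: monics_def)
  moreover have "H dvd smult (inverse (lead_coeff H)) H" by (simp add: dvd_smult)
  moreover have "smult (inverse (lead_coeff H)) H dvd H" using assms by (simp add: smult_dvd_iff)
  ultimately show ?thesis using that by blast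
qed

lemma char_coeff_shift:
  fixes f :: "'c::{field_gcd,finite} poly \<Rightarrow> complex"
  assumes "H \<noteq> 0" "H0 \<in> monics (degree H)"
  shows   "char_coeff f (degree H) = (\<Sum>D\<in>residues_mod H. f (H0 + D))"
  unfolding char_coeff_def residues_mod_eq_polys_less[OF assms(1)]
  by (rule sum.reindex_bij_betw[OF bij_betw_monics[OF assms(2)], symmetric])

section \<open>Vanishing of the high coefficients for characters modulo \<open>H\<close>\<close>

context
  fixes H :: "'c::{field_gcd,finite} poly" and \<chi> :: "'c poly \<Rightarrow> complex"
  assumes H: "H \<noteq> 0" and \<chi>: "mult_char_mod H \<chi>"
begin

lemma monic_char_mult_char_mod: "monic_char \<chi>"
  using mult_char_mod_mult[OF \<chi>] mult_char_mod_1[OF \<chi>] by (simp add: monic_char_def)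

text \<open>Orthogonality: multiplying the residues by \<open>U\<close> permutes the monic
  polynomials of degree \<open>k\<close> and scales the sum by \<open>\<chi> U\<close>, which is not
  1.\<close>

lemma char_coeff_mult_char_mod_eq_0:
  assumes U: "coprime U H" "\<chi> U \<noteq> 1" and k: "k \<ge> degree H"
  shows   "char_coeff \<chi> k = 0"
proof -
  obtain V where V: "H dvd V * U - 1" using coprime_poly_bezout[OF U(1)] by blast
  note VU = mod_inverse_cancel[OF V]
  \<comment> \<open>\<open>T W F\<close> keeps the quotient of \<open>F\<close> by \<open>H\<close>
    and replaces its remainder by that of \<open>W * F\<close>. As \<open>k \<ge> degree H\<close>,
    it stays monic of degree \<open>k\<close>.\<close>
  define T where "T = (\<lambda>W F. F + ((W * F) mod H - F mod H))"
  have T_mod: "T W F mod H = (W * F) mod H" for W F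
  proof -
    have "T W F - W * F = (F - F mod H) - (W * F - (W * F) mod H)" by (simp add: T_def)
    also have "H dvd \<dots>" by (intro dvd_diff dvd_minus_mod)
    finally show ?thesis by (simp add: mod_eq_dvd_iff)
  qed
  have T_in: "T W F \<in> monics k" if "F \<in> monics k" for W F
    unfolding T_def
  proof (rule monics_add_polys_less[OF that])
    have "A mod H \<in> polys_less (degree H)" for A
      using residues_mod_eq_polys_less[OF H] mod_in_residues_mod by blast
    thus "(W * F) mod H - F mod H \<in> polys_less k" using k by (simp add: polys_less_def)
  qed
  have TT: "T W (T W' F) = F" if "\<And>D. (W * (W' * D)) mod H = D mod H" for W W' F
  proof -
    have "(W * T W' F) mod H = (W * (W' * F)) mod H"
      by (rule mod_mult_cong[OF refl T_mod])
    hence "T W (T W' F) = T W' F + (F mod H - (W' * F) mod H)"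
      using that T_mod[of W' F] by (simp add: T_def)
    thus ?thesis by (simp add: T_def)
  qed
  have "bij_betw (T U) (monics k) (monics k)"
    by (rule bij_betwI[where g = "T V"]) (use T_in TT VU in auto)
  hence "char_coeff \<chi> k = (\<Sum>F\<in>monics k. \<chi> (T U F))"
    unfolding char_coeff_def by (rule sum.reindex_bij_betw [symmetric])
  also have "\<dots> = (\<Sum>F\<in>monics k. \<chi> U * \<chi> F)"
  proof (intro sum.cong refl)
    fix F have "\<chi> (T U F) = \<chi> (U * F)"
      using T_mod[of U F] by (intro mult_char_mod_cong[OF \<chi>]) (simp add: mod_eq_dvd_iff)
    thus "\<chi> (T U F) = \<chi> U * \<chi> F" by (simp add: mult_char_mod_mult[OF \<chi>])
  qed
  also have "\<dots> = \<chi> U * char_coeff \<chi> k" by (simp add: char_coeff_def sum_distrib_left)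
  finally show ?thesis using U(2) by simp
qed

context
  fixes lam :: "'c \<Rightarrow> complex"
  assumes lam: "additive_char lam" "\<not> principal_additive lam"
begin

definition "twisted_char F = \<chi> F * lam (second_coeff F)"

lemma monic_char_twisted_char: "monic_char twisted_char"
proof -
  have "twisted_char (F * G) = twisted_char F * twisted_char G"
    if "lead_coeff F = 1" "lead_coeff G = 1" for F G
    using second_coeff_mult[of F "degree F" G "degree G"] that
    by (simp add: twisted_char_def mult_char_mod_mult[OF \<chi>] additive_char_add[OF lam(1)] monics_def)
  moreover have "twisted_char 1 = 1"
    by (simp add: twisted_char_def mult_char_mod_1[OF \<chi>] second_coeff_def additive_char_0[OF lam(1)])
  ultimately show ?thesis by (simp add: monic_char_def)
qed

text \<open>Adding to \<open>F\<close> a multiple of \<open>H\<close> with degree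
  \<open>k - 1\<close> and leading coefficient \<open>a\<close> leaves \<open>\<chi>\<close> alone
  and contributes the factor \<open>lam a\<close>, which is not 1. Such a multiple exists because
  \<open>k > degree H\<close>.\<close>

lemma char_coeff_twisted_char_eq_0:
  assumes k: "k > degree H"
  shows   "char_coeff twisted_char k = 0"
proof -
  obtain H0 where H0: "H0 \<in> monics (degree H)" "H dvd H0" using monic_multiple[OF H] by blast
  obtain a where a: "lam a \<noteq> 1" using lam(2) by (auto simp: principal_additive_def)
  define T where "T = monom a (k - 1 - degree H) * H0"
  have "degree H0 = degree H" "coeff H0 (degree H) = 1" using H0 by (auto simp: monics_def)
  have "T \<in> polys_less k"
    using H0(1) k unfolding T_def polys_less_def monics_def
    by (auto simp: coeff_monom_mult coeff_eq_0)
  have "coeff T (k - 1) = a"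
    using H0(1) k by (auto simp: T_def coeff_monom_mult monics_def)
  have "H dvd T" using H0(2) by (simp add: T_def)
  have mT: "- T \<in> polys_less k" using \<open>T \<in> polys_less k\<close> by (simp add: polys_less_def)
  have "bij_betw (\<lambda>F. F + T) (monics k) (monics k)"
    by (rule bij_betwI[where g = "\<lambda>F. F + - T"])
       (use \<open>T \<in> polys_less k\<close> mT in \<open>blast intro: monics_add_polys_less | simp\<close>)+
  hence "char_coeff twisted_char k = (\<Sum>F\<in>monics k. twisted_char (F + T))"
    unfolding char_coeff_def by (rule sum.reindex_bij_betw [symmetric])
  also have "\<dots> = (\<Sum>F\<in>monics k. lam a * twisted_char F)"
  proof (intro sum.cong refl)
    fix F :: "'c poly" assume F: "F \<in> monics k"
    have "\<chi> (F + T) = \<chi> F" by (rule mult_char_mod_cong[OF \<chi>]) (use \<open>H dvd T\<close> in simp)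
    moreover have "second_coeff (F + T) = second_coeff F + a"
      using second_coeff_add[OF F \<open>T \<in> polys_less k\<close>] k \<open>coeff T (k - 1) = a\<close> by simp
    ultimately show "twisted_char (F + T) = lam a * twisted_char F"
      by (simp add: twisted_char_def additive_char_add[OF lam(1)])
  qed
  also have "\<dots> = lam a * char_coeff twisted_char k" by (simp add: char_coeff_def sum_distrib_left)
  finally show ?thesis using a by simp
qed

end

end

section \<open>Lifted character sums as coefficients of the lifted series\<close>

context finite_field_ext
begin

text \<open>This takes the place of surjectivity of the norm on units. If \<open>\<chi>\<close> were
  not principal, its coefficient at \<open>degree H\<close> would vanish, hence also that of the
  lift, by \<open>char_coeff_NM\<close>; but the latter counts the units modulo
  \<open>J H\<close>.\<close>

lemma principal_if_lift_principal:
  assumes H: "H \<noteq> 0" and \<chi>: "mult_char_mod H \<chi>"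
    and lift: "\<And>B. coprime B (J H) \<Longrightarrow> \<chi> (NM B) = 1"
    and U: "coprime U H"
  shows   "\<chi> U = 1"
proof (rule ccontr)
  assume neq: "\<chi> U \<noteq> 1"
  let ?m = "degree H"
  obtain H0 where H0: "H0 \<in> monics ?m" "H dvd H0" using monic_multiple[OF H] by blast
  have 0: "char_coeff \<chi> k = 0" if "k \<ge> ?m" for k
    using char_coeff_mult_char_mod_eq_0[OF H \<chi> U neq that] .
  have "(-1) ^ ?m * char_coeff (\<lambda>B. \<chi> (NM B)) ?m = ((-1) ^ ?m * char_coeff \<chi> ?m) ^ n"
    by (rule char_coeff_NM[OF monic_char_mult_char_mod[OF H \<chi>]]) (simp add: 0)
  hence "char_coeff (\<lambda>B. \<chi> (NM B)) ?m = 0" using n by (simp add: 0 power_0_left)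
  moreover have "char_coeff (\<lambda>B. \<chi> (NM B)) (degree (J H)) =
                   (\<Sum>D\<in>residues_mod (J H). \<chi> (NM (J H0 + D)))"
    by (rule char_coeff_shift) (use H H0 in auto)
  moreover have "\<chi> (NM (J H0 + D)) = \<chi> (NM D)" for D
    by (rule mult_char_mod_cong[OF \<chi> NM_cong]) (use H0 in simp)
  ultimately have "(\<Sum>D\<in>residues_mod (J H). \<chi> (NM D)) = 0" by simp
  also have "\<chi> (NM D) = of_nat (if coprime D (J H) then 1 else 0)" for D
    using lift[of D] \<chi> by (auto simp: mult_char_mod_def coprime_NM_iff)
  hence "(\<Sum>D\<in>residues_mod (J H). \<chi> (NM D)) =
           of_nat (\<Sum>D\<in>residues_mod (J H). if coprime D (J H) then 1 else 0)"
    by simp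
  finally have *: "(\<Sum>D\<in>residues_mod (J H). if coprime D (J H) then 1 else 0 :: nat) = 0"
    by (simp only: of_nat_eq_0_iff)
  \<comment> \<open>The witness is \<open>1 mod J H\<close> rather than 1, which is no residue when
    \<open>H\<close> is constant.\<close>
  have "coprime (1 mod J H) (J H)"
    using coprime_cong_dvd[of "J H" "1 mod J H" 1] by (simp flip: mod_eq_dvd_iff)
  moreover have "finite (residues_mod (J H))" using H by simp
  ultimately show False using * mod_in_residues_mod[of 1 "J H"] by (auto simp del: mod_in_residues_mod)
qed

text \<open>The norm is a product of monic conjugates, and the second coefficient turns it into a
  sum.\<close>

lemma second_coeff_NM:
  assumes B: "B \<in> monics k" and k: "k > 0"
  shows   "second_coeff (NM B) = coeff (TR B) (k - 1)"
proof -
  have s: "second_coeff (J A) = \<iota> (second_coeff A)" for A by (simp add: second_coeff_def)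
  have "\<iota> (second_coeff (NM B)) = (\<Sum>i=1..n. second_coeff ((\<sigma> ^^ i) B))"
    unfolding s[symmetric] J_NM by (rule second_coeff_prod) (rule monics_\<sigma>_pow[OF B])
  also have "\<dots> = (\<Sum>i=1..n. coeff ((\<sigma> ^^ i) B) (k - 1))"
    using monics_\<sigma>_pow[OF B] k by (intro sum.cong refl) (auto simp: second_coeff_def monics_def)
  also have "\<dots> = \<iota> (coeff (TR B) (k - 1))"
    by (simp add: J_TR coeff_sum flip: coeff_J)
  finally show ?thesis using inj_\<iota> by (simp add: inj_eq)
qed

lemma TR_polys_less: "D \<in> polys_less k \<Longrightarrow> TR D \<in> polys_less k"
proof -
  assume "D \<in> polys_less k"
  hence "J (TR D) \<in> polys_less k"
    using q_gt_1 by (auto simp: J_TR polys_less_def coeff_sum coeff_\<sigma>_pow power_0_left)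
  thus "TR D \<in> polys_less k" by (simp add: polys_less_def)
qed

text \<open>The case \<open>G = 1\<close>. The shift by \<open>H0\<close> turns the coefficient at
  \<open>degree H\<close> into the Gauss sum times \<open>lam c\<close>, with \<open>c\<close> the
  second coefficient of \<open>H0\<close>. On the lift the factor is \<open>lam c ^ n\<close>,
  because \<open>TR (J H0)\<close> is \<open>of_nat n * H0\<close>, so both factors cancel.\<close>

lemma gauss_sum_lift_trivial_twist:
  assumes H: "H \<noteq> 0" and \<chi>: "mult_char_mod H \<chi>"
    and lam: "additive_char lam" "\<not> principal_additive lam"
  shows "(-1) ^ degree H * (\<Sum>D\<in>residues_mod (J H). \<chi> (NM D) * lam (top_coeff_mod H (TR D)))
       = ((-1) ^ degree H * (\<Sum>D\<in>residues_mod H. \<chi> D * lam (top_coeff_mod H D))) ^ n"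
proof (cases "degree H = 0")
  \<comment> \<open>A constant \<open>H\<close> has the single residue 0 and no second coefficient
    to use; both sums are 1.\<close>
  case True
  have "residues_mod H = {0}" "residues_mod (J H) = {0}"
    using H True by (auto simp: residues_mod_eq_polys_less polys_less_altdef)
  moreover have "is_unit H" using H True by (simp add: is_unit_iff_degree)
  hence "\<chi> A = 1" for A
    using mult_char_mod_cong[OF \<chi>, of A 1] mult_char_mod_1[OF \<chi>] by (simp add: unit_imp_dvd)
  ultimately show ?thesis using True by (simp add: top_coeff_mod_def additive_char_0[OF lam(1)])
next
  case False
  let ?m = "degree H" and ?f = "twisted_char \<chi> lam"
  obtain H0 where H0: "H0 \<in> monics ?m" "H dvd H0" using monic_multiple[OF H] by blast
  let ?c = "second_coeff H0"
  have f: "?f = (\<lambda>F. \<chi> F * lam (second_coeff F))"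
    by (rule ext) (rule twisted_char_def[OF H \<chi> lam])
  have top: "top_coeff_mod H D = coeff D (?m - 1)" if "D \<in> polys_less ?m" for D
    using False that by (auto simp: top_coeff_mod_def polys_less_altdef mod_poly_less)
  have "char_coeff ?f ?m = (\<Sum>D\<in>residues_mod H. ?f (H0 + D))"
    by (rule char_coeff_shift[OF H H0(1)])
  also have "\<dots> = (\<Sum>D\<in>residues_mod H. lam ?c * (\<chi> D * lam (top_coeff_mod H D)))"
  proof (intro sum.cong refl)
    fix D assume "D \<in> residues_mod H"
    hence D: "D \<in> polys_less ?m" by (simp add: residues_mod_eq_polys_less[OF H])
    have "\<chi> (H0 + D) = \<chi> D" by (rule mult_char_mod_cong[OF \<chi>]) (use H0 in simp)
    thus "?f (H0 + D) = lam ?c * (\<chi> D * lam (top_coeff_mod H D))"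
      using second_coeff_add[OF H0(1) D] False
      by (simp add: f top[OF D] additive_char_add[OF lam(1)])
  qed
  finally have 1: "char_coeff ?f ?m = lam ?c * (\<Sum>D\<in>residues_mod H. \<chi> D * lam (top_coeff_mod H D))"
    by (simp add: sum_distrib_left)

  have "char_coeff (\<lambda>B. ?f (NM B)) (degree (J H)) = (\<Sum>D\<in>residues_mod (J H). ?f (NM (J H0 + D)))"
    by (rule char_coeff_shift) (use H H0 in auto)
  also have "\<dots> = (\<Sum>D\<in>residues_mod (J H). lam ?c ^ n * (\<chi> (NM D) * lam (top_coeff_mod H (TR D))))"
  proof (intro sum.cong refl)
    fix D assume "D \<in> residues_mod (J H)"
    hence D: "D \<in> polys_less ?m" using H by (simp add: residues_mod_eq_polys_less)
    have "\<chi> (NM (J H0 + D)) = \<chi> (NM D)"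
      by (rule mult_char_mod_cong[OF \<chi> NM_cong]) (use H0 in simp)
    moreover have "J H0 + D \<in> monics ?m" by (rule monics_add_polys_less[OF _ D]) (use H0 in simp)
    hence "second_coeff (NM (J H0 + D)) = coeff (TR (J H0 + D)) (?m - 1)"
      using False by (intro second_coeff_NM) auto
    hence "second_coeff (NM (J H0 + D)) = of_nat n * ?c + coeff (TR D) (?m - 1)"
      using H0(1) False by (simp add: TR_add TR_J second_coeff_def monics_def of_nat_poly)
    ultimately show "?f (NM (J H0 + D)) = lam ?c ^ n * (\<chi> (NM D) * lam (top_coeff_mod H (TR D)))"
      by (simp add: f top[OF TR_polys_less[OF D]] additive_char_add[OF lam(1)]
            additive_char_of_nat_mult[OF lam(1)])
  qed
  finally have 2: "char_coeff (\<lambda>B. ?f (NM B)) ?m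
      = lam ?c ^ n * (\<Sum>D\<in>residues_mod (J H). \<chi> (NM D) * lam (top_coeff_mod H (TR D)))"
    by (simp add: sum_distrib_left)
  have "(-1) ^ ?m * char_coeff (\<lambda>B. ?f (NM B)) ?m = ((-1) ^ ?m * char_coeff ?f ?m) ^ n"
    by (rule char_coeff_NM[OF monic_char_twisted_char[OF H \<chi> lam]])
       (rule char_coeff_twisted_char_eq_0[OF H \<chi> lam])
  thus ?thesis using additive_char_nonzero[OF lam(1), of ?c]
    by (simp add: 1 2 power_mult_distrib)
qed

abbreviation "lift_gauss_sum H \<chi> \<psi> \<equiv> gauss_sum (J H) (\<lambda>A. \<chi> (NM A)) (\<lambda>A. \<psi> (TR A))"

text \<open>Substituting \<open>U * D\<close> for \<open>D\<close>, with \<open>U\<close> an inverse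
  of \<open>G\<close> modulo \<open>H\<close>, reduces to \<open>G = 1\<close> at the cost of
  \<open>\<chi> U\<close>. Over the extension \<open>J U\<close> costs \<open>\<chi> U ^ n\<close>,
  since its norm is \<open>U ^ n\<close>.\<close>

lemma gauss_sum_lift_coprime:
  assumes H: "H \<noteq> 0" and \<chi>: "mult_char_mod H \<chi>"
    and lam: "additive_char lam" "\<not> principal_additive lam" and G: "coprime G H"
  shows "(-1) ^ degree H * lift_gauss_sum H \<chi> (E_char lam G H)
       = ((-1) ^ degree H * gauss_sum H \<chi> (E_char lam G H)) ^ n"
proof -
  obtain U where U: "H dvd U * G - 1" "coprime U H" using coprime_poly_bezout[OF G] by blast
  have top: "top_coeff_mod H (G * (U * D)) = top_coeff_mod H D" for D
    using dvd_mult2[OF U(1), of D] by (intro top_coeff_mod_cong) (simp add: algebra_simps)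
  have "gauss_sum H \<chi> (E_char lam G H) =
          (\<Sum>D\<in>residues_mod H. \<chi> (U * D) * lam (top_coeff_mod H (G * (U * D))))"
    unfolding gauss_sum_def E_char_def
  proof (rule sum_residues_mult_unit[OF H U(2), symmetric])
    fix A B assume "H dvd A - B"
    moreover from this have "H dvd G * A - G * B" by (simp flip: right_diff_distrib)
    ultimately show "\<chi> A * lam (top_coeff_mod H (G * A)) = \<chi> B * lam (top_coeff_mod H (G * B))"
      using mult_char_mod_cong[OF \<chi>] top_coeff_mod_cong by metis
  qed
  also have "\<dots> = \<chi> U * (\<Sum>D\<in>residues_mod H. \<chi> D * lam (top_coeff_mod H D))"
    by (simp add: top mult_char_mod_mult[OF \<chi>] sum_distrib_left mult.assoc)
  finally have 1: "gauss_sum H \<chi> (E_char lam G H) = \<dots>" .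
  have "lift_gauss_sum H \<chi> (E_char lam G H) =
          (\<Sum>D\<in>residues_mod (J H). \<chi> (NM (J U * D)) * lam (top_coeff_mod H (G * TR (J U * D))))"
    unfolding gauss_sum_def E_char_def
  proof (rule sum_residues_mult_unit[symmetric])
    fix A B assume *: "J H dvd A - B"
    have "H dvd G * TR A - G * TR B"
      using TR_cong[OF *] by (simp flip: right_diff_distrib)
    thus "\<chi> (NM A) * lam (top_coeff_mod H (G * TR A)) = \<chi> (NM B) * lam (top_coeff_mod H (G * TR B))"
      using mult_char_mod_cong[OF \<chi> NM_cong[OF *]] top_coeff_mod_cong by metis
  qed (use H U in auto)
  also have "\<dots> = \<chi> U ^ n * (\<Sum>D\<in>residues_mod (J H). \<chi> (NM D) * lam (top_coeff_mod H (TR D)))"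
    by (simp add: top mult_char_mod_mult[OF \<chi>] mult_char_mod_power[OF \<chi>] sum_distrib_left
          mult.assoc NM_mult NM_J TR_J_mult)
  finally have 2: "lift_gauss_sum H \<chi> (E_char lam G H) = \<dots>" .
  show ?thesis
    using gauss_sum_lift_trivial_twist[OF H \<chi> lam] unfolding 1 2 by (simp add: power_mult_distrib mult_ac)
qed

end

subsection \<open>Change of modulus\<close>

definition units_mod :: "'c::field poly \<Rightarrow> 'c poly set" where
  "units_mod H = {D \<in> residues_mod H. coprime D H}"

lemma finite_units_mod [simp]: "H \<noteq> 0 \<Longrightarrow> finite (units_mod (H :: 'c::{field,finite} poly))"
  by (simp add: units_mod_def)

lemma euler_phi_eq_card_units_mod:
  fixes H :: "'c::field_gcd poly"
  shows "euler_phi H = card (units_mod H)"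
proof -
  have "(\<exists>E. (D * E) mod H = 1 mod H) \<longleftrightarrow> coprime D H" for D
  proof
    assume "\<exists>E. (D * E) mod H = 1 mod H"
    then obtain E where E: "H dvd D * E - 1" by (auto simp: mod_eq_dvd_iff)
    have "coprime (D * E) H" using coprime_cong_dvd[OF E] by simp
    thus "coprime D H" by simp
  next
    assume "coprime D H"
    then obtain U where "H dvd U * D - 1" using coprime_poly_bezout by blast
    thus "\<exists>E. (D * E) mod H = 1 mod H" by (auto simp: mod_eq_dvd_iff mult.commute)
  qed
  thus ?thesis by (simp add: euler_phi_def units_mod_def)
qed

lemma coprime_mod_iff [simp]:
  fixes H :: "'c::field_gcd poly"
  shows "coprime (A mod H) H \<longleftrightarrow> coprime A H"
  by (rule coprime_cong_dvd) (simp flip: mod_eq_dvd_iff)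

lemma mod_in_units_mod_iff [simp]:
  fixes H :: "'c::field_gcd poly"
  shows "A mod H \<in> units_mod H \<longleftrightarrow> coprime A H"
  by (simp add: units_mod_def)

lemma euler_phi_pos:
  fixes H :: "'c::{field_gcd,finite} poly"
  assumes "H \<noteq> 0"
  shows   "euler_phi H > 0"
proof -
  have "1 mod H \<in> units_mod H" by simp
  hence "units_mod H \<noteq> {}" by blast
  thus ?thesis using assms by (auto simp: euler_phi_eq_card_units_mod card_gt_0_iff)
qed

text \<open>Move \<open>gcd H N\<close> from \<open>H\<close> to the second factor and repeat; each
  round lowers the degree, until the remaining factor is coprime to \<open>N\<close>.\<close>

lemma split_coprime_part:
  fixes H N :: "'c::field_gcd poly"
  assumes "H \<noteq> 0"
  obtains H1 H2 r where "H = H1 * H2" "coprime H1 N" "H2 dvd N ^ r"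
proof -
  have "\<exists>H1 H2 r. H = H1 * H2 \<and> coprime H1 N \<and> H2 dvd N ^ r"
    using assms
  proof (induction "degree H" arbitrary: H rule: less_induct)
    case less
    show ?case
    proof (cases "coprime H N")
      case True
      thus ?thesis by (intro exI[of _ H] exI[of _ 1]) auto
    next
      case False
      define g where "g = gcd H N"
      obtain K where K: "H = g * K" unfolding g_def by (metis dvdE gcd_dvd1)
      have nz: "g \<noteq> 0" "K \<noteq> 0" using less.prems K by auto
      have "\<not> is_unit g" using False by (simp add: g_def coprime_iff_gcd_eq_1)
      hence "degree g > 0" using nz by (simp add: is_unit_iff_degree)
      hence "degree K < degree H" using nz by (simp add: K degree_mult_eq)
      from less.hyps[OF this nz(2)] obtain H1 H2 r
        where H12: "K = H1 * H2" "coprime H1 N" "H2 dvd N ^ r" by blast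
      have "g * H2 dvd N ^ Suc r" using H12(3) by (auto simp: g_def intro: mult_dvd_mono)
      thus ?thesis using H12 K
        by (intro exI[of _ H1] exI[of _ "g * H2"] exI[of _ "Suc r"]) (auto simp: mult_ac)
    qed
  qed
  thus ?thesis using that by blast
qed

text \<open>Chinese remaindering: \<open>B\<close> is \<open>A\<close> modulo \<open>N\<close> and 1
  modulo the part of \<open>H\<close> coprime to \<open>N\<close>. The other part divides a power of
  \<open>N\<close>, to which \<open>B\<close> is coprime along with \<open>A\<close>.\<close>

lemma coprime_lift:
  fixes A H N :: "'c::field_gcd poly"
  assumes H: "H \<noteq> 0" and A: "coprime A N"
  obtains B where "N dvd B - A" "coprime B H"
proof -
  obtain H1 H2 r where H12: "H = H1 * H2" "coprime H1 N" "H2 dvd N ^ r"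
    using split_coprime_part[OF H] by blast
  obtain V where V: "H1 dvd V * N - 1"
    using coprime_poly_bezout[of N H1] H12(2) by (metis coprime_commute)
  define B where "B = A + (1 - A) * (V * N)"
  have 1: "N dvd B - A" by (simp add: B_def)
  have "B - 1 = (1 - A) * (V * N - 1)" by (simp add: B_def algebra_simps)
  hence "H1 dvd B - 1" using V by simp
  hence "coprime B H1" using coprime_cong_dvd[of H1 B 1] by simp
  moreover have "coprime B N" using coprime_cong_dvd[OF 1] A by simp
  hence "coprime B H2" using coprime_divisors[OF dvd_refl H12(3)] by simp
  ultimately show ?thesis using that 1 by (simp add: H12(1))
qed

text \<open>The fibres of the reduction from units modulo \<open>H\<close> to units modulo
  \<open>N\<close> all have the same size, since a unit \<open>B\<close> lifting \<open>C\<close>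
  carries the fibre over 1 to the fibre over \<open>C\<close>. Taking 1 for \<open>f\<close>
  expresses this size by the two Euler functions.\<close>

lemma sum_units_mod_change_modulus:
  fixes H N :: "'c::{field_gcd,finite} poly" and f :: "'c poly \<Rightarrow> complex"
  assumes H: "H \<noteq> 0" and N: "N dvd H" and f: "\<And>A B. N dvd A - B \<Longrightarrow> f A = f B"
  shows "of_nat (euler_phi N) * (\<Sum>D\<in>units_mod H. f D) = of_nat (euler_phi H) * (\<Sum>C\<in>units_mod N. f C)"
proof -
  have nz: "N \<noteq> 0" using H N by auto
  define fib where "fib = (\<lambda>C. {D. D \<in> units_mod H \<and> D mod N = C})"
  define c where "c = card (fib (1 mod N))"
  have card_fib: "card (fib C) = c" if C: "C \<in> units_mod N" for C
  proof -
    have "coprime C N" "C mod N = C" using C by (auto simp: units_mod_def residues_mod_iff)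
    obtain B where B: "N dvd B - C" "coprime B H" using coprime_lift[OF H \<open>coprime C N\<close>] by blast
    obtain V where V: "H dvd V * B - 1" "coprime V H" using coprime_poly_bezout[OF B(2)] by blast
    have BC: "B mod N = C" using B(1) \<open>C mod N = C\<close> by (simp flip: mod_eq_dvd_iff)
    note VBH = mod_inverse_cancel[OF V(1)]
    have VC: "(V * C) mod N = 1 mod N"
    proof -
      have "N dvd V * B - 1" using V(1) N dvd_trans by blast
      hence "(V * B) mod N = 1 mod N" by (simp add: mod_eq_dvd_iff)
      thus ?thesis by (metis BC mod_mult_right_eq)
    qed
    have "bij_betw (\<lambda>D. (B * D) mod H) (fib (1 mod N)) (fib C)"
    proof (rule bij_betwI[where g = "\<lambda>D. (V * D) mod H"])
      show "(\<lambda>D. (B * D) mod H) \<in> fib (1 mod N) \<rightarrow> fib C"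
      proof
        fix D assume D: "D \<in> fib (1 mod N)"
        have "(B * D) mod N = (B * 1) mod N"
          by (rule mod_mult_cong) (use D in \<open>simp_all add: fib_def\<close>)
        thus "(B * D) mod H \<in> fib C"
          using D B BC N by (simp add: fib_def mod_mod_cancel) (simp add: units_mod_def)
      qed
      show "(\<lambda>D. (V * D) mod H) \<in> fib C \<rightarrow> fib (1 mod N)"
      proof
        fix D assume D: "D \<in> fib C"
        have "(V * D) mod N = (V * C) mod N"
          by (rule mod_mult_cong) (use D \<open>C mod N = C\<close> in \<open>simp_all add: fib_def\<close>)
        thus "(V * D) mod H \<in> fib (1 mod N)"
          using D V VC N by (simp add: fib_def mod_mod_cancel) (simp add: units_mod_def)
      qed
    qed (auto simp: fib_def mod_mult_right_eq VBH units_mod_def residues_mod_iff)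
    thus ?thesis unfolding c_def by (rule bij_betw_same_card [symmetric])
  qed
  have red: "(\<lambda>D. D mod N) ` units_mod H \<subseteq> units_mod N"
    using coprime_divisors[OF dvd_refl N] by (auto simp: units_mod_def)
  have *: "(\<Sum>D\<in>units_mod H. g D) = of_nat c * (\<Sum>C\<in>units_mod N. g C)"
    if g: "\<And>A B. N dvd A - B \<Longrightarrow> g A = g B" for g :: "'c poly \<Rightarrow> complex"
  proof -
    have "(\<Sum>D\<in>units_mod H. g D) = (\<Sum>C\<in>units_mod N. \<Sum>D | D \<in> units_mod H \<and> D mod N = C. g D)"
      by (rule sum.group [symmetric]) (use H nz red in auto)
    also have "\<dots> = (\<Sum>C\<in>units_mod N. \<Sum>D | D \<in> units_mod H \<and> D mod N = C. g C)"
      by (rule sum.cong[OF refl], rule sum.cong[OF refl], rule g)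
         (auto simp flip: mod_eq_dvd_iff)
    also have "\<dots> = (\<Sum>C\<in>units_mod N. of_nat c * g C)"
      by (intro sum.cong refl) (simp add: card_fib[unfolded fib_def])
    finally show ?thesis by (simp add: sum_distrib_left)
  qed
  have "of_nat (euler_phi H) = (of_nat c * of_nat (euler_phi N) :: complex)"
    using *[of "\<lambda>_. 1"] by (simp add: euler_phi_eq_card_units_mod)
  thus ?thesis using *[OF f] by simp
qed

lemma gauss_sum_eq_sum_units_mod:
  fixes H :: "'c::{field_gcd,finite} poly"
  assumes "H \<noteq> 0" and "\<And>A. \<not> coprime A H \<Longrightarrow> \<chi> A = 0"
  shows   "gauss_sum H \<chi> \<psi> = (\<Sum>D\<in>units_mod H. \<chi> D * \<psi> D)"
  unfolding gauss_sum_def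
  by (rule sum.mono_neutral_right) (use assms in \<open>auto simp: units_mod_def\<close>)

lemma gauss_sum_eq_0:
  fixes H :: "'c::{field_gcd,finite} poly"
  assumes H: "H \<noteq> 0" and A: "coprime A H" "\<chi> A \<noteq> 1"
    and \<chi>: "\<And>D. \<chi> (A * D) = \<chi> A * \<chi> D" and \<psi>: "\<And>D. \<psi> (A * D) = \<psi> D"
    and cong: "\<And>D D'. H dvd D - D' \<Longrightarrow> \<chi> D = \<chi> D' \<and> \<psi> D = \<psi> D'"
  shows   "gauss_sum H \<chi> \<psi> = 0"
proof -
  have "gauss_sum H \<chi> \<psi> = (\<Sum>D\<in>residues_mod H. \<chi> (A * D) * \<psi> (A * D))"
    unfolding gauss_sum_def by (rule sum_residues_mult_unit[OF H A(1), symmetric]) (use cong in metis)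
  also have "\<dots> = \<chi> A * gauss_sum H \<chi> \<psi>"
    by (simp add: \<chi> \<psi> gauss_sum_def sum_distrib_left mult.assoc)
  finally show ?thesis using A(2) by simp
qed

text \<open>\<open>triv\<close> makes \<open>\<chi>\<close> agree on any two units modulo
  \<open>H\<close> that are congruent modulo \<open>N\<close>. So \<open>\<chi>'\<close> can be
  defined through an arbitrary lift to a unit modulo \<open>H\<close>, which exists by
  \<open>coprime_lift\<close>.\<close>

lemma mult_char_mod_descend:
  fixes H N :: "'c::field_gcd poly"
  assumes H: "H \<noteq> 0" and N: "N dvd H" and \<chi>: "mult_char_mod H \<chi>"
    and triv: "\<And>A. N dvd A - 1 \<Longrightarrow> coprime A H \<Longrightarrow> \<chi> A = 1"
  obtains \<chi>' where "mult_char_mod N \<chi>'" "\<And>A. coprime A H \<Longrightarrow> \<chi> A = \<chi>' A"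
proof -
  have eq: "\<chi> B = \<chi> B'" if B: "coprime B H" "coprime B' H" "N dvd B - B'" for B B'
  proof -
    obtain V where V: "H dvd V * B - 1" "coprime V H" using coprime_poly_bezout[OF B(1)] by blast
    have 1: "\<chi> V * \<chi> B = 1"
      using mult_char_mod_cong[OF \<chi> V(1)] by (simp add: mult_char_mod_mult[OF \<chi>] mult_char_mod_1[OF \<chi>])
    have "V * B' - 1 = (V * B - 1) - V * (B - B')" by (simp add: algebra_simps)
    hence "N dvd V * B' - 1" using V(1) N B(3) by (metis dvd_diff dvd_mult dvd_trans)
    hence "\<chi> (V * B') = 1" using V(2) B(2) by (intro triv) auto
    hence "\<chi> V * \<chi> B' = 1" by (simp add: mult_char_mod_mult[OF \<chi>])
    moreover have "\<chi> V \<noteq> 0" using 1 by auto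
    ultimately show ?thesis using 1 by (metis mult_left_cancel)
  qed
  define L where "L = (\<lambda>A. SOME B. N dvd B - A \<and> coprime B H)"
  have L: "N dvd L A - A \<and> coprime (L A) H" if "coprime A N" for A
    unfolding L_def by (rule someI_ex) (use coprime_lift[OF H that] in metis)
  define \<chi>' where "\<chi>' = (\<lambda>A. if coprime A N then \<chi> (L A) else 0)"
  have \<chi>'_eq: "\<chi>' A = \<chi> B" if "coprime A N" "N dvd B - A" "coprime B H" for A B
  proof -
    have "L A - B = (L A - A) - (B - A)" by simp
    hence "N dvd L A - B" using L[OF that(1)] that(2) by (metis dvd_diff)
    thus ?thesis using L[OF that(1)] that eq[of "L A" B] by (simp add: \<chi>'_def)
  qed
  have "mult_char_mod N \<chi>'"
    unfolding mult_char_mod_def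
  proof (intro conjI allI impI)
    show "\<chi>' 1 = 1" using \<chi>'_eq[of 1 1] mult_char_mod_1[OF \<chi>] by simp
    show "\<chi>' (A * B) = \<chi>' A * \<chi>' B" if "coprime A N" "coprime B N" for A B
    proof -
      have "L A * L B - A * B = L A * (L B - B) + (L A - A) * B" by (simp add: algebra_simps)
      hence "N dvd L A * L B - A * B" using L that by simp
      hence "\<chi>' (A * B) = \<chi> (L A * L B)" using L that by (intro \<chi>'_eq) auto
      thus ?thesis using that by (simp add: \<chi>'_def mult_char_mod_mult[OF \<chi>])
    qed
    show "\<chi>' A = \<chi>' B" if "N dvd A - B" for A B
    proof (cases "coprime B N")
      case True
      hence "coprime A N" using coprime_cong_dvd[OF that] by simp
      moreover have "L A - B = (L A - A) + (A - B)" by simp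
      hence "N dvd L A - B" using L[OF \<open>coprime A N\<close>] that by (metis dvd_add)
      ultimately show ?thesis using L[OF \<open>coprime A N\<close>] \<chi>'_eq[OF True] by (simp add: \<chi>'_def)
    qed (use coprime_cong_dvd[OF that] in \<open>simp add: \<chi>'_def\<close>)
  qed (simp add: \<chi>'_def)
  moreover have "\<chi> A = \<chi>' A" if "coprime A H" for A
    using \<chi>'_eq[of A A] that coprime_divisors[OF dvd_refl N, of A] by simp
  ultimately show ?thesis using that by blast
qed

text \<open>\<open>H\<close> and \<open>N\<close> have the same prime divisors, so a residue
  \<open>D\<close> is a unit modulo \<open>H\<close> exactly when \<open>D mod N\<close> is a unit
  modulo \<open>N\<close>, while \<open>D div N\<close> ranges freely over
  \<open>degree H - degree N\<close> coefficients.\<close>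

lemma euler_phi_same_radical:
  fixes H N :: "'c::{field_gcd,finite} poly"
  assumes H: "H \<noteq> 0" and N: "N dvd H" and r: "H dvd N ^ r"
  shows   "euler_phi H = CARD('c) ^ (degree H - degree N) * euler_phi N"
proof -
  have nz: "N \<noteq> 0" using H N by auto
  let ?d = "degree H - degree N"
  have le: "degree N \<le> degree H" by (rule dvd_imp_degree_le[OF N H])
  have cop: "coprime A H \<longleftrightarrow> coprime A N" for A
    using coprime_divisors[OF dvd_refl N, of A] coprime_divisors[OF dvd_refl r, of A] by auto
  have divmod: "(C + N * Q) mod N = C" "(C + N * Q) div N = Q" "C mod N = C"
    if "C \<in> units_mod N" for C Q
  proof -
    have "C mod N = C" using that by (simp add: units_mod_def residues_mod_iff)
    moreover from this have "C div N = 0" by (simp add: mod_eq_self_iff_div_eq_0)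
    ultimately show "(C + N * Q) mod N = C" "(C + N * Q) div N = Q" "C mod N = C"
      using nz by auto
  qed
  have "bij_betw (\<lambda>(C, Q). C + N * Q) (units_mod N \<times> polys_less ?d) (units_mod H)"
  proof (rule bij_betwI[where g = "\<lambda>D. (D mod N, D div N)"])
    show "(\<lambda>(C, Q). C + N * Q) \<in> units_mod N \<times> polys_less ?d \<rightarrow> units_mod H"
    proof clarify
      fix C Q :: "'c poly" assume C: "C \<in> units_mod N" and Q: "Q \<in> polys_less ?d"
      have "coprime (C + N * Q) N" using coprime_cong_dvd[of N "C + N * Q" C] C by (simp add: units_mod_def)
      moreover have "C \<in> polys_less (degree H)"
        using C le by (auto simp: units_mod_def residues_mod_eq_polys_less[OF nz] polys_less_def)
      moreover have "N * Q \<in> polys_less (degree H)"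
        using Q nz by (cases "Q = 0") (auto simp: polys_less_altdef degree_mult_eq)
      hence "C + N * Q \<in> polys_less (degree H)"
        using \<open>C \<in> polys_less (degree H)\<close> by (simp add: polys_less_def)
      ultimately show "C + N * Q \<in> units_mod H"
        by (simp add: units_mod_def residues_mod_eq_polys_less[OF H] cop)
    qed
    show "(\<lambda>D. (D mod N, D div N)) \<in> units_mod H \<rightarrow> units_mod N \<times> polys_less ?d"
    proof
      fix D assume D: "D \<in> units_mod H"
      have "D div N \<in> polys_less ?d"
      proof (cases "D div N = 0")
        case False
        have "D \<in> polys_less (degree H)" using D by (simp add: units_mod_def residues_mod_eq_polys_less[OF H])
        moreover have "D mod N \<in> polys_less (degree N)"
          using mod_in_residues_mod residues_mod_eq_polys_less[OF nz] by blast
        ultimately have "D - D mod N \<in> polys_less (degree H)"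
          using le by (simp add: polys_less_def)
        hence "N * (D div N) \<in> polys_less (degree H)" by (simp add: minus_mod_eq_mult_div)
        hence "degree N + degree (D div N) < degree H"
          using False nz by (auto simp: polys_less_altdef degree_mult_eq)
        hence "degree (D div N) < ?d" by linarith
        thus ?thesis by (simp add: polys_less_altdef)
      qed (simp add: polys_less_def)
      thus "(D mod N, D div N) \<in> units_mod N \<times> polys_less ?d"
        using D cop by (simp add: units_mod_def)
    qed
  qed (auto simp: divmod)
  hence "card (units_mod N \<times> (polys_less ?d :: 'c poly set)) = card (units_mod H)"
    by (rule bij_betw_same_card)
  thus ?thesis by (simp add: euler_phi_eq_card_units_mod card_cartesian_product card_polys_less mult.commute)
qed

lemma coeff_monic_mult:
  assumes D: "D \<in> monics d" and R: "R \<in> polys_less (Suc k)"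
  shows   "coeff (D * R) (d + k) = coeff R k"
proof (cases "degree R = k")
  case True
  thus ?thesis using D coeff_mult_degree_sum[of D R] by (auto simp: monics_def)
next
  case False
  hence *: "R = 0 \<or> degree R < k" using R by (auto simp: polys_less_altdef)
  moreover have "degree (D * R) < d + k" if "degree R < k"
    using degree_mult_le[of D R] D that by (auto simp: monics_def)
  ultimately show ?thesis by (auto simp: coeff_eq_0)
qed

text \<open>Reducing a multiple of \<open>D\<close> modulo \<open>D * N\<close> gives
  \<open>D\<close> times a reduction modulo \<open>N\<close>, and the monic \<open>D\<close> only
  shifts the top coefficient. Hence \<open>E_char lam (D * G) (D * N)\<close> is
  \<open>E_char lam G N\<close>.\<close>

lemma top_coeff_mod_mult:
  assumes D: "D \<in> monics d" and N: "N \<noteq> 0"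
  shows   "top_coeff_mod (D * N) (D * X) = top_coeff_mod N X"
proof -
  have nz: "D \<noteq> 0" using D by simp
  have deg: "degree (D * N) = d + degree N" using D N by (auto simp: monics_def degree_mult_eq)
  have "(D * X) mod (D * N) = D * (X mod N)" by (rule mult_mod_right [symmetric])
  moreover have "X mod N = 0" if "degree N = 0"
    using that N by (metis degree_mod_less less_nat_zero_code)
  moreover have "coeff (D * (X mod N)) (d + (degree N - 1)) = coeff (X mod N) (degree N - 1)"
    if "degree N > 0"
    by (rule coeff_monic_mult[OF D])
       (use that residues_mod_eq_polys_less[OF N] mod_in_residues_mod[of X N] in auto)
  ultimately show ?thesis using deg by (auto simp: top_coeff_mod_def)
qed

section \<open>Characters modulo \<open>H\<close> seen from the divisor \<open>N\<close>\<close>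

context finite_field_ext
begin

text \<open>
  Split \<open>H\<close> into a part coprime to \<open>N\<close>, to which \<open>principal_if_lift_principal\<close>
  applies, and a part dividing a power of \<open>N\<close>. On the latter every \<open>A\<close> congruent to 1 is a norm, by
  successive approximation with \<open>NM (1 + M B) \<equiv> 1 + M TR B\<close> modulo \<open>M\<^sup>2\<close>.
\<close>
lemma lift_nontrivial:
  assumes H: "H \<noteq> 0" and N: "N dvd H" and \<chi>: "mult_char_mod H \<chi>"
    and A: "N dvd A - 1" "coprime A H" "\<chi> A \<noteq> 1"
  obtains B where "J N dvd B - 1" "coprime B (J H)" "\<chi> (NM B) \<noteq> 1"
proof -
  have False if lift: "\<And>B. J N dvd B - 1 \<Longrightarrow> coprime B (J H) \<Longrightarrow> \<chi> (NM B) = 1"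
  proof -
    obtain H1 H2 r where H12: "H = H1 * H2" "coprime H1 N" "H2 dvd N ^ r"
      using split_coprime_part[OF H] by blast
    \<comment> \<open>The successor ensures that \<open>N\<close> divides \<open>N ^ R\<close> also
      when \<open>r = 0\<close>.\<close>
    define R where "R = Suc r"
    have H_dvd: "H dvd H1 * N ^ R" using H12 by (simp add: R_def dvd_mult mult_dvd_mono)
    have nz: "H1 \<noteq> 0" using H H12 by auto
    have copR: "coprime H1 (N ^ R)" using H12(2) by simp
    obtain V where V: "H1 dvd V * N ^ R - 1"
      using coprime_poly_bezout[of "N ^ R" H1] copR by (metis coprime_commute)
    \<comment> \<open>\<open>e\<close> is the Chinese remainder idempotent: 1 modulo
      \<open>H1\<close> and 0 modulo \<open>N ^ R\<close>.\<close>
    define e where "e = V * N ^ R"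
    have e1: "H1 dvd e - 1" "H1 dvd 1 - e" using V by (simp_all add: e_def dvd_diff_commute)
    have eN: "N ^ R dvd e" by (simp add: e_def)
    have ee: "H1 * N ^ R dvd e * (1 - e)" using e1(2) eN by (metis mult.commute mult_dvd_mono)
    have \<chi>_cong: "\<chi> X = \<chi> Y" if "H1 * N ^ R dvd X - Y" for X Y
      by (rule mult_char_mod_cong[OF \<chi>]) (use that H_dvd dvd_trans in blast)

    \<comment> \<open>The component of \<open>\<chi>\<close> at \<open>H1\<close>: its argument is
      \<open>X\<close> modulo \<open>H1\<close> and 1 modulo \<open>N ^ R\<close>.\<close>
    define \<chi>1 where "\<chi>1 = (\<lambda>X. \<chi> (X * e + (1 - e)))"
    have \<chi>1: "mult_char_mod H1 \<chi>1"
      unfolding mult_char_mod_def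
    proof (intro conjI allI impI)
      show "\<chi>1 1 = 1" by (simp add: \<chi>1_def mult_char_mod_1[OF \<chi>])
    next
      fix X Y
      have "(X * e + (1 - e)) * (Y * e + (1 - e)) - (X * Y * e + (1 - e))
          = (e * (1 - e)) * (X + Y - X * Y - 1)"
        by (simp add: algebra_simps)
      hence "\<chi> ((X * e + (1 - e)) * (Y * e + (1 - e))) = \<chi> (X * Y * e + (1 - e))"
        using ee by (intro \<chi>_cong) simp
      thus "\<chi>1 (X * Y) = \<chi>1 X * \<chi>1 Y" by (simp add: \<chi>1_def mult_char_mod_mult[OF \<chi>])
    next
      fix X Y assume "H1 dvd X - Y"
      hence "H1 * N ^ R dvd (X - Y) * e" using eN by (rule mult_dvd_mono)
      thus "\<chi>1 X = \<chi>1 Y" unfolding \<chi>1_def by (intro \<chi>_cong) (simp add: algebra_simps)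
    next
      fix X assume X: "\<not> coprime X H1"
      have "X * e + (1 - e) - X = (X - 1) * (e - 1)" by (simp add: algebra_simps)
      hence "H1 dvd X * e + (1 - e) - X" using e1 by simp
      hence "\<not> coprime (X * e + (1 - e)) H1" using X coprime_cong_dvd by blast
      hence "\<not> coprime (X * e + (1 - e)) H" by (simp add: H12(1))
      thus "\<chi>1 X = 0" using \<chi> by (simp add: \<chi>1_def mult_char_mod_def)
    qed
    have lift1: "\<chi>1 (NM B) = 1" if B: "coprime B (J H1)" for B
    proof -
      \<comment> \<open>The same interpolation over the extension: \<open>B'\<close> is
        \<open>B\<close> modulo \<open>J H1\<close> and 1 modulo \<open>J (N ^ R)\<close>, so
        \<open>lift\<close> applies to it.\<close>
      define B' where "B' = B * J e + J (1 - e)"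
      have B'1: "J H1 dvd B' - B"
      proof -
        have "B' - B = (B - 1) * J (e - 1)" by (simp add: B'_def J_diff algebra_simps)
        thus ?thesis using e1 by simp
      qed
      have B'N: "J (N ^ R) dvd B' - 1"
      proof -
        have "B' - 1 = (B - 1) * J e" by (simp add: B'_def J_diff algebra_simps)
        thus ?thesis using eN by simp
      qed
      have "J N dvd J (N ^ R)" by (simp add: R_def)
      hence "J N dvd B' - 1" using B'N dvd_trans by blast
      moreover have "coprime B' (J (H1 * N ^ R))"
        using coprime_cong_dvd[OF B'1] coprime_cong_dvd[OF B'N] B by (simp add: J_mult)
      hence "coprime B' (J H)" using coprime_divisors[OF dvd_refl, of "J H"] H_dvd by (metis J_dvd_iff)
      ultimately have "\<chi> (NM B') = 1" by (rule lift)
      moreover have "H1 * N ^ R dvd (NM B * e + (1 - e)) - NM B'"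
      proof (rule divides_mult)
        have "(NM B * e + (1 - e)) - NM B' = (NM B - 1) * (e - 1) - (NM B' - NM B)"
          by (simp add: algebra_simps)
        thus "H1 dvd (NM B * e + (1 - e)) - NM B'"
          using e1(1) NM_cong[OF B'1] by (metis dvd_diff dvd_mult)
        have "(NM B * e + (1 - e)) - NM B' = (NM B - 1) * e - (NM B' - NM 1)"
          by (simp add: algebra_simps)
        thus "N ^ R dvd (NM B * e + (1 - e)) - NM B'"
          using eN NM_cong[OF B'N] by (metis dvd_diff dvd_mult)
      qed (rule copR)
      ultimately show ?thesis using \<chi>_cong by (simp add: \<chi>1_def)
    qed
    have "coprime A H1" using A(2) by (simp add: H12(1))
    hence A1: "\<chi>1 A = 1" using principal_if_lift_principal[OF nz \<chi>1 lift1] by blast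

    \<comment> \<open>Descending induction on \<open>s\<close> from \<open>R\<close>, where the
      congruence modulo \<open>H1 * N ^ R\<close> already decides \<open>\<chi> A\<close>. In the
      step a norm \<open>W\<close> agrees with \<open>A\<close> modulo
      \<open>(H1 * N ^ s) ^ 2\<close>, a multiple of \<open>H1 * N ^ Suc s\<close> as
      \<open>s \<ge> 1\<close>; so \<open>V * A\<close>, with \<open>V\<close> inverse to
      \<open>W\<close>, is closer to 1.\<close>
    have A2: "\<chi> A = 1" if "s \<ge> 1" "s \<le> R" "H1 * N ^ s dvd A - 1" for s A
      using that(2,1,3)
    proof (induction s arbitrary: A rule: inc_induct)
      case base
      thus ?case using \<chi>_cong[of A 1] mult_char_mod_1[OF \<chi>] by simp
    next
      case (step s)
      define M where "M = H1 * N ^ s"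
      obtain C where C: "A - 1 = M * C" using step.prems(2) by (auto simp: M_def)
      obtain B where B: "TR B = C" using TR_surj by blast
      define W where "W = NM (1 + J M * B)"
      have WA: "M ^ 2 dvd W - A"
        using NM_one_plus[of M B] C by (simp add: W_def B algebra_simps)
      have "N ^ R dvd (N ^ s) ^ R"
        unfolding power_mult [symmetric] using step.prems(1) by (intro le_imp_power_dvd) simp
      moreover have "H1 dvd H1 ^ R" by (simp add: R_def)
      ultimately have HM: "H1 * N ^ R dvd M ^ R"
        unfolding M_def power_mult_distrib by (intro mult_dvd_mono)
      have "coprime (1 + J M * B) (J M)"
        using coprime_cong_dvd[of "J M" "1 + J M * B" 1] by simp
      hence "coprime (1 + J M * B) (J (M ^ R))" by (simp add: J_power)
      hence copW: "coprime (1 + J M * B) (J (H1 * N ^ R))"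
        using coprime_divisors[OF dvd_refl] HM by (metis J_dvd_iff)
      have "coprime (1 + J M * B) (J H)"
        using coprime_divisors[OF dvd_refl _ copW] H_dvd by (metis J_dvd_iff)
      moreover have "N dvd M" using step.prems(1) by (cases s) (auto simp: M_def)
      ultimately have \<chi>W: "\<chi> W = 1" unfolding W_def by (intro lift) auto
      have "coprime W (H1 * N ^ R)" unfolding W_def coprime_NM_iff by (rule copW)
      then obtain V where V: "H1 * N ^ R dvd V * W - 1" using coprime_poly_bezout by blast
      have "H1 * N ^ Suc s dvd M ^ 2"
      proof -
        have "M ^ 2 = H1 * (H1 * N ^ (s + s))"
          by (simp add: M_def power2_eq_square power_add mult_ac)
        moreover have "N ^ Suc s dvd N ^ (s + s)" using step.prems(1) by (intro le_imp_power_dvd) simp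
        ultimately show ?thesis by (metis dvd_mult mult_dvd_mono dvd_refl)
      qed
      hence "H1 * N ^ Suc s dvd V * (W - A)" using WA dvd_trans by (metis dvd_mult)
      moreover have "H1 * N ^ Suc s dvd H1 * N ^ R"
        using step.hyps by (intro mult_dvd_mono le_imp_power_dvd) auto
      hence "H1 * N ^ Suc s dvd V * W - 1" using V dvd_trans by blast
      moreover have "V * A - 1 = (V * W - 1) - V * (W - A)" by (simp add: algebra_simps)
      ultimately have "H1 * N ^ Suc s dvd V * A - 1" by (metis dvd_diff)
      hence \<chi>VA: "\<chi> (V * A) = 1" by (intro step.IH) auto
      have "W * (V * A) - A = (V * W - 1) * A" by (simp add: algebra_simps)
      hence "\<chi> (W * (V * A)) = \<chi> A" using V by (intro \<chi>_cong) simp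
      thus ?case using mult_char_mod_mult[OF \<chi>, of W "V * A"] \<chi>W \<chi>VA by simp
    qed

    have "(e + A * (1 - e)) - 1 = (1 - e) * (A - 1)" by (simp add: algebra_simps)
    hence "H1 * N ^ 1 dvd (e + A * (1 - e)) - 1" using mult_dvd_mono[OF e1(2) A(1)] by simp
    hence "\<chi> (e + A * (1 - e)) = 1" by (intro A2[of 1]) (auto simp: R_def)
    \<comment> \<open>\<open>A\<close> splits into its component at \<open>H1\<close>, settled by
      \<open>A1\<close>, and its component at \<open>N ^ R\<close>, settled by
      \<open>A2\<close>.\<close>
    moreover have "(A * e + (1 - e)) * (e + A * (1 - e)) - A = (e * (1 - e)) * (A * A - 2 * A + 1)"
      by (simp add: algebra_simps)
    hence "\<chi> ((A * e + (1 - e)) * (e + A * (1 - e))) = \<chi> A" using ee by (intro \<chi>_cong) simp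
    ultimately have "\<chi> A = 1" using A1 by (simp add: mult_char_mod_mult[OF \<chi>] \<chi>1_def)
    thus False using A(3) by simp
  qed
  thus ?thesis using that by blast
qed

text \<open>Multiplying the summation variable by a unit congruent to 1 modulo \<open>N\<close>
  fixes \<open>\<psi>\<close> but scales \<open>\<chi>\<close> by a value other than 1. Over the
  extension such a unit comes from \<open>lift_nontrivial\<close>.\<close>

lemma gauss_sum_nontrivial:
  assumes H: "H \<noteq> 0" and N: "N dvd H" and \<chi>: "mult_char_mod H \<chi>"
    and \<psi>: "\<And>A B. N dvd A - B \<Longrightarrow> \<psi> A = \<psi> B"
    and A: "N dvd A - 1" "coprime A H" "\<chi> A \<noteq> 1"
  shows "gauss_sum H \<chi> \<psi> = 0" "lift_gauss_sum H \<chi> \<psi> = 0"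
proof -
  have "\<psi> (A * D) = \<psi> D" for D
    using dvd_mult2[OF A(1), of D] by (intro \<psi>) (simp add: algebra_simps)
  thus "gauss_sum H \<chi> \<psi> = 0"
    by (intro gauss_sum_eq_0[where A = A])
       (use H A mult_char_mod_cong[OF \<chi>] \<psi> dvd_trans[OF N] in \<open>auto simp: mult_char_mod_mult[OF \<chi>]\<close>)
  obtain B where B: "J N dvd B - 1" "coprime B (J H)" "\<chi> (NM B) \<noteq> 1"
    using lift_nontrivial[OF H N \<chi> A] by blast
  have "J N dvd B * D - D" for D
    using dvd_mult2[OF B(1), of D] by (simp add: algebra_simps)
  hence "\<psi> (TR (B * D)) = \<psi> (TR D)" for D by (intro \<psi> TR_cong)
  moreover have "\<chi> (NM D) = \<chi> (NM D') \<and> \<psi> (TR D) = \<psi> (TR D')" if "J H dvd D - D'" for D D'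
    using mult_char_mod_cong[OF \<chi> NM_cong[OF that]] \<psi>[OF dvd_trans[OF N TR_cong[OF that]]] by simp
  ultimately show "lift_gauss_sum H \<chi> \<psi> = 0"
    by (intro gauss_sum_eq_0[where A = B])
       (use H B in \<open>auto simp: mult_char_mod_mult[OF \<chi>] NM_mult\<close>)
qed

text \<open>Where \<open>\<chi>\<close> descends, the Gauss sums modulo \<open>H\<close> and modulo
  \<open>N\<close> differ by a quotient of Euler functions over either field, and what remains is
  \<open>gauss_sum_lift_coprime\<close> modulo \<open>N\<close>. Otherwise both sides are 0.\<close>

lemma gauss_sum_lift:
  assumes H: "H \<noteq> 0" and DN: "H = D * N" and D: "D \<in> monics d" and G: "coprime G N"
    and \<chi>: "mult_char_mod H \<chi>" and lam: "additive_char lam" "\<not> principal_additive lam"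
  shows "(-1) ^ degree N * (of_nat (euler_phi (J N)) / of_nat (euler_phi (J H)))
           * lift_gauss_sum H \<chi> (E_char lam (D * G) H)
       = ((-1) ^ degree N * (of_nat (euler_phi N) / of_nat (euler_phi H))
           * gauss_sum H \<chi> (E_char lam (D * G) H)) ^ n"
proof -
  have nz: "N \<noteq> 0" and N: "N dvd H" using H DN by auto
  define \<psi> where "\<psi> = E_char lam G N"
  have E: "E_char lam (D * G) H = \<psi>"
    by (rule ext) (simp add: E_char_def DN \<psi>_def mult.assoc top_coeff_mod_mult[OF D nz])
  have \<psi>: "\<psi> A = \<psi> B" if "N dvd A - B" for A B
  proof -
    have "N dvd G * A - G * B" using that by (simp flip: right_diff_distrib)
    thus ?thesis unfolding \<psi>_def E_char_def using top_coeff_mod_cong by metis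
  qed
  show ?thesis
  proof (cases "\<exists>A. N dvd A - 1 \<and> coprime A H \<and> \<chi> A \<noteq> 1")
    case True
    then obtain A where A: "N dvd A - 1" "coprime A H" "\<chi> A \<noteq> 1" by blast
    show ?thesis
      using gauss_sum_nontrivial[where \<psi> = \<psi>, OF H N \<chi> \<psi> A] n unfolding E by (simp add: power_0_left)
  next
    case False
    then obtain \<chi>' where \<chi>': "mult_char_mod N \<chi>'" "\<And>A. coprime A H \<Longrightarrow> \<chi> A = \<chi>' A"
      using mult_char_mod_descend[OF H N \<chi>] by metis
    have z: "\<chi> A = 0" if "\<not> coprime A H" for A using that \<chi> by (simp add: mult_char_mod_def)
    have z': "\<chi>' A = 0" if "\<not> coprime A N" for A using that \<chi>'(1) by (simp add: mult_char_mod_def)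
    have "gauss_sum H \<chi> \<psi> = (\<Sum>D\<in>units_mod H. \<chi>' D * \<psi> D)"
      by (subst gauss_sum_eq_sum_units_mod[OF H z]) (auto simp: units_mod_def \<chi>'(2) intro!: sum.cong)
    moreover have "gauss_sum N \<chi>' \<psi> = (\<Sum>D\<in>units_mod N. \<chi>' D * \<psi> D)"
      by (rule gauss_sum_eq_sum_units_mod[OF nz z'])
    moreover have "of_nat (euler_phi N) * (\<Sum>D\<in>units_mod H. \<chi>' D * \<psi> D)
        = of_nat (euler_phi H) * (\<Sum>D\<in>units_mod N. \<chi>' D * \<psi> D)"
      by (rule sum_units_mod_change_modulus[OF H N])
         (use mult_char_mod_cong[OF \<chi>'(1)] \<psi> in metis)
    ultimately have 1: "of_nat (euler_phi N) * gauss_sum H \<chi> \<psi> = of_nat (euler_phi H) * gauss_sum N \<chi>' \<psi>"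
      by simp
    have JH: "J H \<noteq> 0" and JN: "J N \<noteq> 0" "J N dvd J H" using H N nz by auto
    have zJ: "\<chi> (NM A) = 0" if "\<not> coprime A (J H)" for A using that z by (simp add: coprime_NM_iff)
    have zJ': "\<chi>' (NM A) = 0" if "\<not> coprime A (J N)" for A using that z' by (simp add: coprime_NM_iff)
    have "lift_gauss_sum H \<chi> \<psi> = (\<Sum>D\<in>units_mod (J H). \<chi>' (NM D) * \<psi> (TR D))"
      by (subst gauss_sum_eq_sum_units_mod[OF JH zJ])
         (auto simp: units_mod_def \<chi>'(2) coprime_NM_iff intro!: sum.cong)
    moreover have "lift_gauss_sum N \<chi>' \<psi> = (\<Sum>D\<in>units_mod (J N). \<chi>' (NM D) * \<psi> (TR D))"
      by (rule gauss_sum_eq_sum_units_mod[OF JN(1) zJ'])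
    moreover have "of_nat (euler_phi (J N)) * (\<Sum>D\<in>units_mod (J H). \<chi>' (NM D) * \<psi> (TR D))
        = of_nat (euler_phi (J H)) * (\<Sum>D\<in>units_mod (J N). \<chi>' (NM D) * \<psi> (TR D))"
      by (rule sum_units_mod_change_modulus[OF JH JN(2)])
         (use mult_char_mod_cong[OF \<chi>'(1) NM_cong] \<psi>[OF TR_cong] in metis)
    ultimately have 2: "of_nat (euler_phi (J N)) * lift_gauss_sum H \<chi> \<psi>
        = of_nat (euler_phi (J H)) * lift_gauss_sum N \<chi>' \<psi>"
      by simp
    have pos: "of_nat (euler_phi H) \<noteq> (0 :: complex)" "of_nat (euler_phi (J H)) \<noteq> (0 :: complex)"
      using euler_phi_pos[OF H] euler_phi_pos[OF JH] by auto
    have "of_nat (euler_phi N) / of_nat (euler_phi H) * gauss_sum H \<chi> \<psi> = gauss_sum N \<chi>' \<psi>"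
      using 1 pos by (simp add: field_simps)
    moreover have "of_nat (euler_phi (J N)) / of_nat (euler_phi (J H)) * lift_gauss_sum H \<chi> \<psi>
        = lift_gauss_sum N \<chi>' \<psi>"
      using 2 pos by (simp add: field_simps)
    moreover have "(-1) ^ degree N * lift_gauss_sum N \<chi>' \<psi> = ((-1) ^ degree N * gauss_sum N \<chi>' \<psi>) ^ n"
      unfolding \<psi>_def by (rule gauss_sum_lift_coprime[OF nz \<chi>'(1) lam G])
    ultimately show ?thesis unfolding E by (simp only: mult.assoc)
  qed
qed

end

theorem theorem1p3:
  fixes \<iota> :: "'a::{field_gcd,finite} \<Rightarrow> 'b::{field_gcd,finite}"
    and n m m1 :: nat
    and lam :: "'a \<Rightarrow> complex"
    and H G N :: "'a poly"
    and \<chi> \<psi> :: "'a poly \<Rightarrow> complex"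
  assumes "n \<ge> 1"
    and "field_embedding \<iota>"
    and "CARD('b) = CARD('a) ^ n"
    and "additive_char lam" and "\<not> principal_additive lam"
    and "H \<noteq> 0" and "m = degree H"
    and "mult_char_mod H \<chi>"
    and "additive_char_mod H \<psi>"
    and "\<not> (principal_mult_mod H \<chi> \<and> principal_additive \<psi>)"
    and "associated_poly lam H \<psi> G"
    and "m1 = degree (gcd G H)"
    and "N = H div gcd G H"
  shows "(-1) ^ (m - m1)
           * (of_nat (euler_phi (map_poly \<iota> N)) / of_nat (euler_phi (map_poly \<iota> H)))
           * gauss_sum (map_poly \<iota> H) (lift_mult \<iota> n \<chi>) (lift_additive \<iota> n \<psi>)
         = ((-1) ^ (m - m1) * (of_nat (euler_phi N) / of_nat (euler_phi H))
             * gauss_sum H \<chi> \<psi>) ^ n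
       \<and> (\<forall>P k. k \<ge> 1 \<longrightarrow> irreducible P \<longrightarrow> H = P ^ k \<longrightarrow>
           (-1) ^ (m - m1)
             * gauss_sum (map_poly \<iota> H) (lift_mult \<iota> n \<chi>) (lift_additive \<iota> n \<psi>)
           = ((-1) ^ (m - m1) * gauss_sum H \<chi> \<psi>) ^ n)"
proof -
  interpret finite_field_ext \<iota> n "CARD('a)"
    by unfold_locales (use assms in auto)
  note H = \<open>H \<noteq> 0\<close> and \<chi> = \<open>mult_char_mod H \<chi>\<close>
  define D where "D = gcd G H"
  have D: "D \<in> monics (degree D)"
    by (rule monics_unit_factor) (use H in \<open>auto simp: D_def unit_factor_gcd\<close>)
  have DN: "H = D * N" using assms by (simp add: D_def)
  have N: "N \<noteq> 0" "N dvd H" using H DN by auto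
  \<comment> \<open>\<open>G = 0\<close> is allowed: then \<open>D\<close> is \<open>H\<close> up to
    a unit, \<open>G'\<close> is 0 and \<open>N\<close> is a unit, so coprimality still
    holds.\<close>
  obtain G' where G': "G = D * G'" "coprime G' N"
  proof -
    have "G = D * (G div D)" by (simp add: D_def)
    moreover have "coprime (G div D) N"
      using H assms by (simp add: D_def div_gcd_coprime)
    ultimately show ?thesis using that by blast
  qed
  have deg: "m - m1 = degree N"
    using DN H assms by (metis D_def add_diff_cancel_left' degree_mult_eq mult_eq_0_iff)
  have \<psi>: "\<psi> = E_char lam (D * G') H" using assms G' by (simp add: associated_poly_def)
  have lift: "gauss_sum (map_poly \<iota> H) (lift_mult \<iota> n \<chi>) (lift_additive \<iota> n \<psi>) = lift_gauss_sum H \<chi> \<psi>"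
    by (simp add: lift_mult_def [abs_def] lift_additive_def [abs_def] TR_def NM_def)
  have part1: "(-1) ^ degree N * (of_nat (euler_phi (J N)) / of_nat (euler_phi (J H))) * lift_gauss_sum H \<chi> \<psi>
      = ((-1) ^ degree N * (of_nat (euler_phi N) / of_nat (euler_phi H)) * gauss_sum H \<chi> \<psi>) ^ n"
    unfolding \<psi> by (rule gauss_sum_lift[OF H DN D G'(2) \<chi> assms(4,5)])
  have part2: "(-1) ^ degree N * lift_gauss_sum H \<chi> \<psi> = ((-1) ^ degree N * gauss_sum H \<chi> \<psi>) ^ n"
    if k: "k \<ge> 1" and P: "irreducible P" and HP: "H = P ^ k" for P k
  proof (cases "is_unit N")
    \<comment> \<open>Here \<open>\<psi>\<close> is principal, so \<open>\<chi>\<close> is not, and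
      both Gauss sums vanish.\<close>
    case True
    have "H dvd D" using DN True by (metis dvd_mult_unit_iff dvd_refl)
    hence HG: "H dvd G * A" for A by (simp add: D_def)
    have "\<psi> A = 1" for A
      using HG[of A] assms(4) by (simp add: \<psi> G'(1)[symmetric] E_char_def top_coeff_mod_def
        additive_char_0 mod_eq_0_iff_dvd)
    hence "principal_additive \<psi>" and \<psi>1: "\<And>A B. \<psi> A = \<psi> B"
      by (auto simp: principal_additive_def)
    then obtain A where A: "coprime A H" "\<chi> A \<noteq> 1"
      using assms by (auto simp: principal_mult_mod_def)
    have "N dvd A - 1" using True by (rule unit_imp_dvd)
    thus ?thesis
      using gauss_sum_nontrivial[where \<psi> = \<psi>, OF H N(2) \<chi> \<psi>1 _ A] n by (simp add: power_0_left)
  next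
    case False
    \<comment> \<open>A nonunit divisor of \<open>P ^ k\<close> is divisible by \<open>P\<close>, so
      \<open>N\<close> has the same prime divisors as \<open>H\<close>.\<close>
    have "P dvd N"
    proof (rule ccontr)
      assume "\<not> P dvd N"
      hence "coprime P N" using P prime_elem_imp_coprime irreducible_imp_prime_elem by blast
      hence "coprime (P ^ k) N" by simp
      thus False using N(2) False HP by (metis coprime_common_divisor dvd_refl)
    qed
    hence r: "H dvd N ^ k" using HP dvd_power_same by blast
    let ?d = "degree H - degree N" and ?q = "of_nat CARD('a) :: complex"
    have phi: "euler_phi H = CARD('a) ^ ?d * euler_phi N"
      by (rule euler_phi_same_radical[OF H N(2) r])
    have phiJ: "euler_phi (J H) = CARD('b) ^ (degree (J H) - degree (J N)) * euler_phi (J N)"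
      by (rule euler_phi_same_radical[where r = k]) (use H N r in \<open>simp_all flip: J_power\<close>)
    have q: "?q \<noteq> 0" by simp
    \<comment> \<open>The Euler quotient over the large field is the \<open>n\<close>-th power of
      this one, so both cancel from \<open>part1\<close>.\<close>
    have "of_nat (euler_phi N) / of_nat (euler_phi H) = 1 / ?q ^ ?d"
      using euler_phi_pos[OF N(1)] by (simp add: phi)
    moreover have "of_nat (euler_phi (J H)) = (?q ^ ?d) ^ n * of_nat (euler_phi (J N))"
      by (simp add: phiJ card_ext mult.commute[of n] flip: power_mult)
    hence "of_nat (euler_phi (J N)) / of_nat (euler_phi (J H)) = (1 / ?q ^ ?d) ^ n"
      using euler_phi_pos[of "J N"] N(1) by (simp add: power_divide)
    ultimately have "(1 / ?q ^ ?d) ^ n * ((-1) ^ degree N * lift_gauss_sum H \<chi> \<psi>)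
        = (1 / ?q ^ ?d) ^ n * ((-1) ^ degree N * gauss_sum H \<chi> \<psi>) ^ n"
      using part1 by (simp only: mult_ac flip: power_mult_distrib)
    thus ?thesis using q by simp
  qed
  show ?thesis unfolding deg lift using part1 part2 by blast
qed

end
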